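(* There is a permutation model of ZFA in which CS and CWF hold but $LOKW_4^-$ fails, and moreover in which: (1) for every $3\le k<\omega$ and all graphs $G_1,G_2$ with $V_{G_1}$ linearly orderable, $\chi(E_{G_1})=k$ and $\chi(E_{G_2})\ge\omega$ imply $\chi(E_{G_1\times G_2})=k$; (2) for every infinite graph $G=(V_G,E_G)$ on a linearly ordered vertex set and every finite graph $H$, if every finite subgraph of $G$ has a homomorphism into $H$ then $G$ has a homomorphism into $H$; (3) for every finite field $\mathcal{F}=\langle F,\dots\rangle$ and every nontrivial linearly orderable vector space $V$ over $\mathcal{F}$ there is a non-zero linear functional $f:V\to F$.
   Context: CS: every partially ordered set without a maximal element has two disjoint cofinal subsets. CWF: every partially ordered set has a cofinal well-founded subset. $LOKW_4^-$: every infinite linearly orderable family $\mathcal{A}$ of $4$-element sets has a partial Kinna–Wegner selection function, i.e., there are an infinite $\mathcal{B}\subseteq\mathcal{A}$ and a function $f$ on $\mathcal{B}$ with $\emptyset\ne f(B)\subsetneq B$ for all $B\in\mathcal{B}$. A good coloring of $G$ is a map $f$ on $V_G$ with $f(x)\ne f(y)$ for $\{x,y\}\in E_G$; $\chi(E_G)$ is the least cardinal $\kappa$ such that $G$ has a good coloring with $\kappa$ colors; $\chi(E_G)\ge\omega$ means no finite good coloring exists. $G_1\times G_2$ has vertex set $V_{G_1}\times V_{G_2}$ and edges $\{(x_0,x_1),(y_0,y_1)\}$ with $\{x_0,y_0\}\in E_{G_1}$ and $\{x_1,y_1\}\in E_{G_2}$. A homomorphism $G\to H$ is a map $V_G\to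 V_H$ sending edges to edges. *)

theory Defs
  imports "HOL-Algebra.Bij" "HOL-Algebra.Module"
begin

text \<open>
  First-order structures for the language of ZFA. An element of the universe is either an atom or
  a set. The membership relation may be defined on more than the universe; only its restriction to
  the universe is ever used.
\<close>

record 'v zfa_structure =
  Univ :: "'v set"
  Mem :: "'v \<Rightarrow> 'v \<Rightarrow> bool"
  Atoms :: "'v set"

datatype fm = FMem nat nat | FEq nat nat | FAtom nat | FNeg fm | FConj fm fm | FAll nat fm

text \<open>
  Everything in the following locale is the meaning of a set-theoretic notion \<^emph>\<open>inside\<close> the
  structure S: objects that set theory regards as sets (subsets, relations, functions,
  natural numbers, \<dots>) range over elements of the universe of S. The functions
  \<open>elts\<close>, \<open>rel\<close> and \<open>app\<close> decode such elements; library predicates are applied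
  to the decoded objects only if they amount to conditions on elements alone (so they mean the same
  inside S), e.g. \<open>partial_order_on\<close>, \<open>bij_betw\<close>, \<open>field\<close>, \<open>module\<close>
  or \<open>card X = 4\<close>, but not \<open>finite\<close> or \<open>wf\<close>.
\<close>

locale in_structure =
  fixes S :: "'v zfa_structure"
begin

definition elts :: "'v \<Rightarrow> 'v set" where
  "elts x = {y \<in> Univ S. Mem S y x}"

definition sets :: "'v set" where
  "sets = Univ S - Atoms S"

primrec sat :: "fm \<Rightarrow> (nat \<Rightarrow> 'v) \<Rightarrow> bool" where
  "sat (FMem i j) e \<longleftrightarrow> Mem S (e i) (e j)"
| "sat (FEq i j) e \<longleftrightarrow> e i = e j"
| "sat (FAtom i) e \<longleftrightarrow> e i \<in> Atoms S"
| "sat (FNeg \<phi>) e \<longleftrightarrow> \<not> sat \<phi> e"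
| "sat (FConj \<phi> \<psi>) e \<longleftrightarrow> sat \<phi> e \<and> sat \<psi> e"
| "sat (FAll i \<phi>) e \<longleftrightarrow> (\<forall>x\<in>Univ S. sat \<phi> (e(i := x)))"


subsection \<open>Natural numbers\<close>

definition is_empty :: "'v \<Rightarrow> bool" where
  "is_empty x \<longleftrightarrow> x \<in> sets \<and> elts x = {}"

definition is_succ :: "'v \<Rightarrow> 'v \<Rightarrow> bool" where
  "is_succ y x \<longleftrightarrow> y \<in> sets \<and> elts y = insert x (elts x)"

definition inductive_in :: "'v \<Rightarrow> bool" where
  "inductive_in I \<longleftrightarrow> I \<in> sets \<and> (\<exists>z\<in>elts I. is_empty z) \<and> (\<forall>x\<in>elts I. \<exists>y\<in>elts I. is_succ y x)"

definition natural :: "'v \<Rightarrow> bool" where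
  "natural n \<longleftrightarrow> n \<in> Univ S \<and> (\<forall>I\<in>Univ S. inductive_in I \<longrightarrow> n \<in> elts I)"

primrec is_numeral :: "nat \<Rightarrow> 'v \<Rightarrow> bool" where
  "is_numeral 0 x \<longleftrightarrow> is_empty x"
| "is_numeral (Suc n) x \<longleftrightarrow> (\<exists>y\<in>Univ S. is_numeral n y \<and> is_succ x y)"


subsection \<open>The axioms\<close>

definition replacement_schema :: bool where
  "replacement_schema \<longleftrightarrow>
    (\<forall>\<phi> e. \<forall>x\<in>Univ S. range e \<subseteq> Univ S \<and>
      (\<forall>u\<in>elts x. \<forall>v\<in>Univ S. \<forall>w\<in>Univ S.
         sat \<phi> (e(0 := u, 1 := v)) \<and> sat \<phi> (e(0 := u, 1 := w)) \<longrightarrow> v = w) \<longrightarrow>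
      (\<exists>y\<in>sets. elts y = {v \<in> Univ S. \<exists>u\<in>elts x. sat \<phi> (e(0 := u, 1 := v))}))"

definition ZFA :: bool where
  "ZFA \<longleftrightarrow>
    Atoms S \<subseteq> Univ S \<and>
    (\<forall>a\<in>Atoms S. elts a = {}) \<and>
    (\<exists>A\<in>sets. elts A = Atoms S) \<and>
    (\<forall>x\<in>sets. \<forall>y\<in>sets. elts x = elts y \<longrightarrow> x = y) \<and>
    (\<forall>x\<in>Univ S. elts x \<noteq> {} \<longrightarrow> (\<exists>y\<in>elts x. elts y \<inter> elts x = {})) \<and>
    (\<forall>x\<in>Univ S. \<forall>y\<in>Univ S. \<exists>z\<in>sets. elts z = {x, y}) \<and>
    (\<forall>x\<in>Univ S. \<exists>u\<in>sets. elts u = (\<Union>y\<in>elts x. elts y)) \<and>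
    (\<forall>x\<in>sets. \<exists>p\<in>sets. elts p = {y \<in> sets. elts y \<subseteq> elts x}) \<and>
    (\<exists>I\<in>Univ S. inductive_in I) \<and>
    replacement_schema"

definition choice :: bool where
  "choice \<longleftrightarrow>
    (\<forall>X\<in>Univ S. (\<forall>x\<in>elts X. elts x \<noteq> {}) \<and>
      (\<forall>x\<in>elts X. \<forall>y\<in>elts X. x \<noteq> y \<longrightarrow> elts x \<inter> elts y = {}) \<longrightarrow>
      (\<exists>c\<in>sets. \<forall>x\<in>elts X. \<exists>!y. y \<in> elts c \<inter> elts x))"

text \<open>
  A ground universe of ZFA + AC, playing the role of the class V of everything. The
  classes of V are rendered as arbitrary HOL predicates and functions, so that replacement is
  available for all of them and not only for those definable by a formula. With an empty set of
  atoms this is a universe of ZFC.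
\<close>

definition ground :: bool where
  "ground \<longleftrightarrow> ZFA \<and> choice \<and>
    (\<forall>f. \<forall>x\<in>Univ S. f ` elts x \<subseteq> Univ S \<longrightarrow> (\<exists>y\<in>sets. elts y = f ` elts x))"


subsection \<open>Symmetric sets\<close>

definition normal_filter :: "('v \<Rightarrow> 'v) set \<Rightarrow> ('v \<Rightarrow> 'v) set set \<Rightarrow> bool" where
  "normal_filter G \<F> \<longleftrightarrow>
    subgroup G (BijGroup (Atoms S)) \<and>
    (\<forall>H\<in>\<F>. subgroup H (BijGroup (Atoms S)) \<and> H \<subseteq> G) \<and>
    G \<in> \<F> \<and>
    (\<forall>H\<in>\<F>. \<forall>K. subgroup K (BijGroup (Atoms S)) \<and> H \<subseteq> K \<and> K \<subseteq> G \<longrightarrow> K \<in> \<F>) \<and>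
    (\<forall>H\<in>\<F>. \<forall>K\<in>\<F>. H \<inter> K \<in> \<F>) \<and>
    (\<forall>H\<in>\<F>. \<forall>\<pi>\<in>G.
       (\<lambda>h. \<pi> \<otimes>\<^bsub>BijGroup (Atoms S)\<^esub> h \<otimes>\<^bsub>BijGroup (Atoms S)\<^esub> inv\<^bsub>BijGroup (Atoms S)\<^esub> \<pi>) ` H \<in> \<F>) \<and>
    (\<forall>a\<in>Atoms S. {\<pi> \<in> G. \<pi> a = a} \<in> \<F>)"

definition mem_rel :: "('v \<times> 'v) set" where
  "mem_rel = {(y, x). x \<in> Univ S \<and> y \<in> elts x}"

text \<open>The extension of a permutation of the atoms by \<open>\<pi> x = {\<pi> y. y \<in> x}\<close> for sets x.\<close>

definition act :: "('v \<Rightarrow> 'v) \<Rightarrow> 'v \<Rightarrow> 'v" where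
  "act \<pi> = wfrec mem_rel
    (\<lambda>\<phi> x. if x \<in> Atoms S then \<pi> x else (THE z. z \<in> sets \<and> elts z = \<phi> ` elts x))"

definition symmetric :: "('v \<Rightarrow> 'v) set \<Rightarrow> ('v \<Rightarrow> 'v) set set \<Rightarrow> 'v \<Rightarrow> bool" where
  "symmetric G \<F> x \<longleftrightarrow> {\<pi> \<in> G. act \<pi> x = x} \<in> \<F>"

definition hereditarily_symmetric :: "('v \<Rightarrow> 'v) set \<Rightarrow> ('v \<Rightarrow> 'v) set set \<Rightarrow> 'v set" where
  "hereditarily_symmetric G \<F> = {x \<in> Univ S. \<forall>y. (y, x) \<in> mem_rel\<^sup>* \<longrightarrow> symmetric G \<F> y}"


subsection \<open>Relations and functions\<close>

text \<open>Kuratowski pairs.\<close>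

definition is_pair :: "'v \<Rightarrow> 'v \<Rightarrow> 'v \<Rightarrow> bool" where
  "is_pair p x y \<longleftrightarrow> p \<in> Univ S \<and>
    (\<exists>u\<in>Univ S. \<exists>v\<in>Univ S. elts u = {x} \<and> elts v = {x, y} \<and> elts p = {u, v})"

definition is_product :: "'v \<Rightarrow> 'v \<Rightarrow> 'v \<Rightarrow> bool" where
  "is_product P X Y \<longleftrightarrow> P \<in> sets \<and> elts P = {p. \<exists>x\<in>elts X. \<exists>y\<in>elts Y. is_pair p x y}"

definition is_relation :: "'v \<Rightarrow> 'v \<Rightarrow> 'v \<Rightarrow> bool" where
  "is_relation r X Y \<longleftrightarrow> r \<in> sets \<and> (\<forall>p\<in>elts r. \<exists>x\<in>elts X. \<exists>y\<in>elts Y. is_pair p x y)"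

definition rel :: "'v \<Rightarrow> ('v \<times> 'v) set" where
  "rel r = {(x, y). \<exists>p\<in>elts r. is_pair p x y}"

definition is_function :: "'v \<Rightarrow> 'v \<Rightarrow> 'v \<Rightarrow> bool" where
  "is_function f X Y \<longleftrightarrow> is_relation f X Y \<and> (\<forall>x\<in>elts X. \<exists>!y. (x, y) \<in> rel f)"

definition app :: "'v \<Rightarrow> 'v \<Rightarrow> 'v" where
  "app f x = (THE y. (x, y) \<in> rel f)"

definition is_function2 :: "'v \<Rightarrow> 'v \<Rightarrow> 'v \<Rightarrow> 'v \<Rightarrow> bool" where
  "is_function2 f X Y Z \<longleftrightarrow> (\<exists>P\<in>Univ S. is_product P X Y \<and> is_function f P Z)"

definition app2 :: "'v \<Rightarrow> 'v \<Rightarrow> 'v \<Rightarrow> 'v" where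
  "app2 f x y = app f (THE p. is_pair p x y)"

definition finite_in :: "'v \<Rightarrow> bool" where
  "finite_in X \<longleftrightarrow>
    (\<exists>n f. natural n \<and> is_function f X n \<and> bij_betw (app f) (elts X) (elts n))"

definition linearly_orderable :: "'v \<Rightarrow> bool" where
  "linearly_orderable X \<longleftrightarrow> (\<exists>r. is_relation r X X \<and> linear_order_on (elts X) (rel r))"


subsection \<open>Weak choice principles\<close>

definition is_poset :: "'v \<Rightarrow> 'v \<Rightarrow> bool" where
  "is_poset P r \<longleftrightarrow> P \<in> sets \<and> is_relation r P P \<and> partial_order_on (elts P) (rel r)"

definition cofinal :: "'v \<Rightarrow> 'v \<Rightarrow> 'v \<Rightarrow> bool" where
  "cofinal C P r \<longleftrightarrow>
    C \<in> sets \<and> elts C \<subseteq> elts P \<and> (\<forall>p\<in>elts P. \<exists>c\<in>elts C. (p, c) \<in> rel r)"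

definition well_founded :: "'v \<Rightarrow> 'v \<Rightarrow> bool" where
  "well_founded C r \<longleftrightarrow>
    (\<forall>X\<in>sets. elts X \<subseteq> elts C \<and> elts X \<noteq> {} \<longrightarrow>
      (\<exists>m\<in>elts X. \<forall>x\<in>elts X. (x, m) \<in> rel r \<longrightarrow> x = m))"

definition CS :: bool where
  "CS \<longleftrightarrow>
    (\<forall>P r. is_poset P r \<and> \<not> (\<exists>m\<in>elts P. \<forall>x\<in>elts P. (m, x) \<in> rel r \<longrightarrow> x = m) \<longrightarrow>
      (\<exists>C D. cofinal C P r \<and> cofinal D P r \<and> elts C \<inter> elts D = {}))"

definition CWF :: bool where
  "CWF \<longleftrightarrow> (\<forall>P r. is_poset P r \<longrightarrow> (\<exists>C. cofinal C P r \<and> well_founded C r))"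

definition LOKW4_minus :: bool where
  "LOKW4_minus \<longleftrightarrow>
    (\<forall>\<A>\<in>sets. \<not> finite_in \<A> \<and> linearly_orderable \<A> \<and> (\<forall>X\<in>elts \<A>. card (elts X) = 4) \<longrightarrow>
      (\<exists>\<B>\<in>sets. elts \<B> \<subseteq> elts \<A> \<and> \<not> finite_in \<B> \<and>
        (\<exists>f. \<exists>Y\<in>Univ S. is_function f \<B> Y \<and>
          (\<forall>B\<in>elts \<B>. app f B \<in> sets \<and> elts (app f B) \<noteq> {} \<and> elts (app f B) \<subset> elts B))))"


subsection \<open>Graphs\<close>

definition edge :: "'v \<Rightarrow> 'v \<Rightarrow> 'v \<Rightarrow> bool" where
  "edge E x y \<longleftrightarrow> (\<exists>e\<in>elts E. elts e = {x, y})"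

definition graph :: "'v \<Rightarrow> 'v \<Rightarrow> bool" where
  "graph V E \<longleftrightarrow> V \<in> sets \<and> E \<in> sets \<and>
    (\<forall>e\<in>elts E. \<exists>x\<in>elts V. \<exists>y\<in>elts V. x \<noteq> y \<and> elts e = {x, y})"

definition colorable :: "'v \<Rightarrow> 'v \<Rightarrow> 'v \<Rightarrow> bool" where
  "colorable V E k \<longleftrightarrow>
    (\<exists>f. is_function f V k \<and>
      (\<forall>x\<in>elts V. \<forall>y\<in>elts V. edge E x y \<longrightarrow> app f x \<noteq> app f y))"

definition chromatic_number_is :: "'v \<Rightarrow> 'v \<Rightarrow> 'v \<Rightarrow> bool" where
  "chromatic_number_is V E k \<longleftrightarrow>
    natural k \<and> colorable V E k \<and> (\<forall>j\<in>elts k. \<not> colorable V E j)"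

definition chromatic_number_infinite :: "'v \<Rightarrow> 'v \<Rightarrow> bool" where
  "chromatic_number_infinite V E \<longleftrightarrow> (\<forall>n. natural n \<longrightarrow> \<not> colorable V E n)"

definition product_graph :: "'v \<Rightarrow> 'v \<Rightarrow> 'v \<Rightarrow> 'v \<Rightarrow> 'v \<Rightarrow> 'v \<Rightarrow> bool" where
  "product_graph V E V1 E1 V2 E2 \<longleftrightarrow> is_product V V1 V2 \<and> E \<in> sets \<and>
    elts E = {e \<in> Univ S. \<exists>p q x0 x1 y0 y1.
      is_pair p x0 x1 \<and> is_pair q y0 y1 \<and> edge E1 x0 y0 \<and> edge E2 x1 y1 \<and> elts e = {p, q}}"

definition homomorphic :: "'v \<Rightarrow> 'v \<Rightarrow> 'v \<Rightarrow> 'v \<Rightarrow> bool" where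
  "homomorphic V E W D \<longleftrightarrow>
    (\<exists>h. is_function h V W \<and>
      (\<forall>x\<in>elts V. \<forall>y\<in>elts V. edge E x y \<longrightarrow> edge D (app h x) (app h y)))"

definition product_coloring_statement :: bool where
  "product_coloring_statement \<longleftrightarrow>
    (\<forall>k three V1 E1 V2 E2.
      natural k \<and> is_numeral 3 three \<and> elts three \<subseteq> elts k \<and>
      graph V1 E1 \<and> graph V2 E2 \<and> linearly_orderable V1 \<and>
      chromatic_number_is V1 E1 k \<and> chromatic_number_infinite V2 E2 \<longrightarrow>
      (\<exists>V E. product_graph V E V1 E1 V2 E2 \<and> chromatic_number_is V E k))"

definition homomorphism_compactness_statement :: bool where
  "homomorphism_compactness_statement \<longleftrightarrow>
    (\<forall>V E W D.
      graph V E \<and> \<not> finite_in V \<and> linearly_orderable V \<and> graph W D \<and> finite_in W \<and>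
      (\<forall>V' E'. graph V' E' \<and> finite_in V' \<and> elts V' \<subseteq> elts V \<and> elts E' \<subseteq> elts E \<longrightarrow>
        homomorphic V' E' W D) \<longrightarrow>
      homomorphic V E W D)"


subsection \<open>Vector spaces\<close>

definition ring_of :: "'v \<Rightarrow> 'v \<Rightarrow> 'v \<Rightarrow> 'v \<Rightarrow> 'v \<Rightarrow> 'v ring" where
  "ring_of F a m z i =
    \<lparr>carrier = elts F, monoid.mult = app2 m, one = i, zero = z, add = app2 a\<rparr>"

text \<open>The multiplicative fields of the library's module record are irrelevant to \<open>module\<close>.\<close>

definition module_of :: "'v \<Rightarrow> 'v \<Rightarrow> 'v \<Rightarrow> 'v \<Rightarrow> ('v, 'v) module" where
  "module_of V a z s =
    \<lparr>carrier = elts V, monoid.mult = undefined, one = undefined, zero = z, add = app2 a,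
     smult = app2 s\<rparr>"

definition linear_functional_statement :: bool where
  "linear_functional_statement \<longleftrightarrow>
    (\<forall>F aF mF zF iF V aV zV sV.
      F \<in> sets \<and> is_function2 aF F F F \<and> is_function2 mF F F F \<and>
      field (ring_of F aF mF zF iF) \<and> finite_in F \<and>
      V \<in> sets \<and> is_function2 aV V V V \<and> is_function2 sV F V V \<and>
      module (ring_of F aF mF zF iF) (module_of V aV zV sV) \<and>
      (\<exists>v\<in>elts V. v \<noteq> zV) \<and> linearly_orderable V \<longrightarrow>
      (\<exists>f. is_function f V F \<and>
        (\<forall>x\<in>elts V. \<forall>y\<in>elts V. app f (app2 aV x y) = app2 aF (app f x) (app f y)) \<and>
        (\<forall>c\<in>elts F. \<forall>x\<in>elts V. app f (app2 sV c x) = app2 mF c (app f x)) \<and>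
        (\<exists>v\<in>elts V. app f v \<noteq> zF)))"

end

definition permutation_model :: "'v zfa_structure \<Rightarrow> bool" where
  "permutation_model N \<longleftrightarrow>
    (\<exists>S G \<F>. in_structure.ground S \<and> in_structure.normal_filter S G \<F> \<and>
      N = S\<lparr>Univ := in_structure.hereditarily_symmetric S G \<F>\<rparr>)"

end

theory Submission
  imports Defs "HOL-Library.Countable_Set"
begin

text \<open>
  Add infinitely many atoms to the given universe and index them by \<open>nat \<times> bool \<times> bool\<close>; the
  group is a full product of Klein four-groups, the \<open>n\<close>-th of which acts regularly on the block
  \<open>{n} \<times> bool \<times> bool\<close>, and supports are initial segments of the blocks. Each block has four
  elements on which the group acts transitively, so no Kinna--Wegner function exists on infinitely
  many blocks. On the other hand, every group element is an involution, and an automorphism of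
  order two of a poset moves no point to a comparable one. Hence linearly orderable sets are fixed
  pointwise by the stabilizer of an order, which reduces the last three statements to compactness
  and to choice in the metalogic, and the orbits of the stabilizer of a poset form again a poset,
  from which cofinal subsets can be pulled back.
\<close>

section \<open>Consequences of choice in the metalogic\<close>

text \<open>A set pulled back from the orbits lies in the model because it is a union of orbits of
  the stabilizer: such a union is invariant however its orbits were picked, so the picking may use
  full choice outside the model. Orbits are antichains because x <= s x implies s x <= s (s x) = x,
  and the same computation makes the order on orbits antisymmetric.

  The Klein group is transitive on four points, and its elements commute and are their own inverses.
  So inverses and conjugates cost nothing in the filter, and a support of x also supports every
  translate of x.

  In statement (1) only the vertices of the first graph are fixed; those of the second may be moved.
  Still, what such a vertex induces, a coloring by numerals of a finite set of fixed vertices, is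
  constant on orbits, and this makes it available inside the model.

  The model has to live on the type of the given atomless universe, so no new objects can be
  adjoined: some of the old sets must become atoms. Objects chosen in the metalogic become sets
  because \<open>ground\<close> has replacement for all HOL functions.\<close>

lemma finite_target_compactness:
  fixes R :: "'a \<Rightarrow> 'a \<Rightarrow> bool" and Q :: "'b \<Rightarrow> 'b \<Rightarrow> bool"
  assumes "finite D"
    and fin: "\<And>W. finite W \<Longrightarrow> W \<subseteq> V \<Longrightarrow>
      \<exists>h. (\<forall>x\<in>W. h x \<in> D) \<and> (\<forall>x\<in>W. \<forall>y\<in>W. R x y \<longrightarrow> Q (h x) (h y))"
  shows "\<exists>h. (\<forall>x\<in>V. h x \<in> D) \<and> (\<forall>x\<in>V. \<forall>y\<in>V. R x y \<longrightarrow> Q (h x) (h y))"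
proof -
  define hom where "hom W h \<longleftrightarrow> (\<forall>x\<in>W. h x \<in> D) \<and> (\<forall>x\<in>W. \<forall>y\<in>W. R x y \<longrightarrow> Q (h x) (h y))" for W h
  have hom_mono: "hom W' h" if "hom W h" "W' \<subseteq> W" for W W' h
    using that by (auto simp: hom_def)
  define ext where "ext p W h \<longleftrightarrow> hom W h \<and> (\<forall>x\<in>W. \<forall>d. (x, d) \<in> p \<longrightarrow> h x = d)" for p W h
  \<comment> \<open>\<open>p\<close> is a set of prescribed values that stays solvable on every
    finite part of \<open>V\<close>. A maximal such \<open>p\<close> decides every point: if each
    value \<open>d\<close> at \<open>x\<close> were refuted on a finite \<open>W d\<close>, then, as
    \<open>D\<close> is finite, the union of the \<open>W d\<close> together with \<open>x\<close>
    would be a finite part on which \<open>p\<close> has no solution.\<close>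
  define A where "A = {p. p \<subseteq> V \<times> D \<and> (\<forall>W. finite W \<and> W \<subseteq> V \<longrightarrow> (\<exists>h. ext p W h))}"
  have AD: "\<exists>h. ext p W h" if "p \<in> A" "finite W" "W \<subseteq> V" for p W
    using that by (simp add: A_def)
  have "\<exists>M\<in>A. \<forall>X\<in>A. M \<subseteq> X \<longrightarrow> X = M"
  proof (rule subset_Zorn_nonempty)
    have "{} \<in> A"
      using fin by (simp add: A_def ext_def hom_def)
    then show "A \<noteq> {}" by blast
    fix C assume C: "C \<noteq> {}" "subset.chain A C"
    then have CA: "C \<subseteq> A" by (simp add: subset_chain_def)
    show "\<Union>C \<in> A"
      unfolding A_def
    proof (intro CollectI conjI allI impI)
      show "\<Union>C \<subseteq> V \<times> D" using CA by (auto simp: A_def)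
      fix W assume W: "finite W \<and> W \<subseteq> V"
      \<comment> \<open>Because \<open>D\<close> is finite, the union of the chain makes only
        finitely many prescriptions about \<open>W\<close>; these already occur in one member of the
        chain.\<close>
      have "finite (\<Union>C \<inter> W \<times> D)"
        using W assms(1) by blast
      then obtain p where p: "p \<in> C" "\<Union>C \<inter> W \<times> D \<subseteq> p"
        using finite_subset_Union_chain[OF _ _ C, of "\<Union>C \<inter> W \<times> D"] by blast
      with AD[of p W] CA W obtain h where h: "ext p W h" by blast
      have "ext (\<Union>C) W h"
        unfolding ext_def
      proof (intro conjI ballI allI impI)
        show "hom W h" using h by (simp add: ext_def)
        fix x d assume x: "x \<in> W" "(x, d) \<in> \<Union>C"
        then have "d \<in> D" using CA by (auto simp: A_def)
        with x p h show "h x = d" by (auto simp: ext_def)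
      qed
      then show "\<exists>h. ext (\<Union>C) W h" by blast
    qed
  qed
  then obtain p where p: "p \<in> A" and max: "\<And>X. X \<in> A \<Longrightarrow> p \<subseteq> X \<Longrightarrow> X = p" by blast
  have total: "\<exists>d. (x, d) \<in> p" if x: "x \<in> V" for x
  proof (rule ccontr)
    assume no: "\<nexists>d. (x, d) \<in> p"
    have "\<exists>W. finite W \<and> W \<subseteq> V \<and> (\<nexists>h. ext (insert (x, d) p) W h)" if d: "d \<in> D" for d
    proof (rule ccontr)
      assume "\<nexists>W. finite W \<and> W \<subseteq> V \<and> (\<nexists>h. ext (insert (x, d) p) W h)"
      then have "insert (x, d) p \<in> A"
        using p x d unfolding A_def by blast
      from max[OF this] no show False by blast
    qed
    then obtain W where W: "\<And>d. d \<in> D \<Longrightarrow> finite (W d) \<and> W d \<subseteq> V \<and> (\<nexists>h. ext (insert (x, d) p) (W d) h)"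
      by metis
    define W' where "W' = insert x (\<Union>d\<in>D. W d)"
    have "finite W'" "W' \<subseteq> V"
      using W x assms(1) by (auto simp: W'_def)
    from AD[OF p this] obtain h where h: "ext p W' h" by blast
    define d where "d = h x"
    have d: "d \<in> D"
      using h by (auto simp: ext_def hom_def W'_def d_def)
    then have WW: "W d \<subseteq> W'" by (auto simp: W'_def)
    have "ext (insert (x, d) p) (W d) h"
      using h hom_mono[OF _ WW] WW unfolding ext_def d_def by blast
    with W[OF d] show False by blast
  qed
  define h where "h x = (SOME d. (x, d) \<in> p)" for x
  have h: "(x, h x) \<in> p" if "x \<in> V" for x
    using total[OF that] unfolding h_def by (rule someI_ex)
  have "Q (h x) (h y)" if xy: "x \<in> V" "y \<in> V" "R x y" for x y
  proof -
    obtain k where "ext p {x, y} k"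
      using AD[OF p, of "{x, y}"] xy by blast
    with h[OF xy(1)] h[OF xy(2)] xy show ?thesis
      by (auto simp: ext_def hom_def)
  qed
  moreover have "h x \<in> D" if "x \<in> V" for x
    using h[OF that] p by (auto simp: A_def)
  ultimately show ?thesis by blast
qed

lemma ex_disjoint_cofinal:
  fixes P :: "'a set" and le :: "'a \<Rightarrow> 'a \<Rightarrow> bool"
  assumes refl: "\<And>x. x \<in> P \<Longrightarrow> le x x"
    and trans: "\<And>x y z. x \<in> P \<Longrightarrow> y \<in> P \<Longrightarrow> z \<in> P \<Longrightarrow> le x y \<Longrightarrow> le y z \<Longrightarrow> le x z"
    and antisym: "\<And>x y. x \<in> P \<Longrightarrow> y \<in> P \<Longrightarrow> le x y \<Longrightarrow> le y x \<Longrightarrow> x = y"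
    and no_max: "\<And>x. x \<in> P \<Longrightarrow> \<exists>y\<in>P. le x y \<and> y \<noteq> x"
  shows "\<exists>C D. C \<subseteq> P \<and> D \<subseteq> P \<and> C \<inter> D = {} \<and>
    (\<forall>p\<in>P. \<exists>c\<in>C. le p c) \<and> (\<forall>p\<in>P. \<exists>d\<in>D. le p d)"
proof -
  \<comment> \<open>Sets of points colored with two colors, no point having both, such that above
    every point there is one of the other color. The two color classes of a maximal such set turn
    out to be the required sets.\<close>
  define A where "A = {X :: ('a \<times> bool) set. X \<subseteq> P \<times> UNIV \<and>
    (\<forall>p b. (p, b) \<in> X \<longrightarrow> (p, \<not> b) \<notin> X \<and> (\<exists>q. (q, \<not> b) \<in> X \<and> le p q))}"
  have "\<exists>M\<in>A. \<forall>X\<in>A. M \<subseteq> X \<longrightarrow> X = M"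
  proof (rule subset_Zorn')
    fix C assume "subset.chain A C"
    then have CA: "C \<subseteq> A" and C: "\<And>X Y. X \<in> C \<Longrightarrow> Y \<in> C \<Longrightarrow> X \<subseteq> Y \<or> Y \<subseteq> X"
      by (auto simp: subset_chain_def)
    show "\<Union>C \<in> A"
      unfolding A_def
    proof (intro CollectI conjI allI impI)
      show "\<Union>C \<subseteq> P \<times> UNIV" using CA by (auto simp: A_def)
      fix p b assume "(p, b) \<in> \<Union>C"
      then obtain X where X: "X \<in> C" "(p, b) \<in> X" by blast
      have pX: "(p, \<not> b) \<notin> Y" if "Y \<in> A" "(p, b) \<in> Y" for Y
        using that by (auto simp: A_def)
      show "(p, \<not> b) \<notin> \<Union>C"
      proof
        assume "(p, \<not> b) \<in> \<Union>C"
        then obtain Y where Y: "Y \<in> C" "(p, \<not> b) \<in> Y" by blast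
        from C[OF X(1) Y(1)] show False
          using X Y pX CA by blast
      qed
      from X CA show "\<exists>q. (q, \<not> b) \<in> \<Union>C \<and> le p q"
        unfolding A_def by blast
    qed
  qed
  then obtain X where X: "X \<in> A" and max: "\<And>Y. Y \<in> A \<Longrightarrow> X \<subseteq> Y \<Longrightarrow> Y = X" by blast
  have XP: "p \<in> P" if "(p, b) \<in> X" for p b
    using X that by (auto simp: A_def)
  have X1: "(p, \<not> b) \<notin> X" if "(p, b) \<in> X" for p b
    using X that unfolding A_def by blast
  have X2: "\<exists>q. (q, \<not> b) \<in> X \<and> le p q" if "(p, b) \<in> X" for p b
    using X that unfolding A_def by blast
  have cof: "\<exists>q b. (q, b) \<in> X \<and> le p q" if p: "p \<in> P" for p
  proof (rule ccontr)
    assume no: "\<nexists>q b. (q, b) \<in> X \<and> le p q"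
    have "\<exists>f. \<forall>n. (f n \<in> P \<and> le p (f n)) \<and> (le (f n) (f (Suc n)) \<and> f (Suc n) \<noteq> f n)"
    proof (rule dependent_nat_choice)
      show "\<exists>x. x \<in> P \<and> le p x" using p refl by blast
      fix x assume "x \<in> P \<and> le p x"
      then show "\<exists>y. (y \<in> P \<and> le p y) \<and> le x y \<and> y \<noteq> x"
        using no_max[of x] trans p by meson
    qed
    then obtain f where fP: "\<And>n. f n \<in> P" and pf: "\<And>n. le p (f n)"
      and step: "\<And>n. le (f n) (f (Suc n))" "\<And>n. f (Suc n) \<noteq> f n" by blast
    have mono: "le (f m) (f n)" if "m \<le> n" for m n
      using that
    proof (induction rule: dec_induct)
      case base
      then show ?case using refl fP by blast
    next
      case (step k)
      then show ?case using trans[OF fP fP fP] \<open>\<And>n. le (f n) (f (Suc n))\<close> by blast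
    qed
    have neq: "f m \<noteq> f n" if "m < n" for m n
    proof
      assume "f m = f n"
      moreover have "le (f (Suc m)) (f n)" using that by (intro mono) simp
      ultimately have "f (Suc m) = f m" using step(1) antisym[OF fP fP] by metis
      with step(2) show False by blast
    qed
    have inj: "m = n" if "f m = f n" for m n
      using neq[of m n] neq[of n m] that by (metis nat_neq_iff)
    have fX: "(f n, b) \<notin> X" for n b
      using no pf by blast
    \<comment> \<open>If nothing in \<open>X\<close> lies above \<open>p\<close>, then a strictly
      increasing sequence above \<open>p\<close> avoids \<open>X\<close> and can be added with
      alternating colors, contradicting maximality.\<close>
    define Y where "Y = X \<union> range (\<lambda>n. (f n, even n))"
    have "Y \<in> A"
      unfolding A_def
    proof (intro CollectI conjI allI impI)
      show "Y \<subseteq> P \<times> UNIV" using XP fP by (auto simp: Y_def)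
      fix q b assume q: "(q, b) \<in> Y"
      then consider "(q, b) \<in> X" | n where "q = f n" "b = even n" by (auto simp: Y_def)
      then have "(q, \<not> b) \<notin> Y \<and> (\<exists>r. (r, \<not> b) \<in> Y \<and> le q r)"
      proof cases
        case 1
        then have "(q, \<not> b) \<notin> Y"
          using X1 fX by (auto simp: Y_def)
        with X2[OF 1] show ?thesis by (auto simp: Y_def)
      next
        case 2
        have "(q, \<not> b) \<notin> Y"
          using fX inj 2 by (auto simp: Y_def)
        moreover have "(f (Suc n), \<not> b) \<in> Y"
          unfolding Y_def 2 by (rule UnI2, rule image_eqI[of _ _ "Suc n"]) auto
        ultimately show ?thesis
          using step(1)[of n] 2 by blast
      qed
      then show "(q, \<not> b) \<notin> Y" "\<exists>r. (r, \<not> b) \<in> Y \<and> le q r" by blast+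
    qed
    then have "Y = X" by (rule max) (auto simp: Y_def)
    moreover have "(f 0, even (0::nat)) \<in> Y" by (auto simp: Y_def)
    ultimately show False using fX by blast
  qed
  \<comment> \<open>One step upwards inside \<open>X\<close> changes the color, so each color class
    alone is cofinal.\<close>
  have cof': "\<exists>q. (q, b) \<in> X \<and> le p q" if p: "p \<in> P" for p b
  proof -
    obtain q c where q: "(q, c) \<in> X" "le p q" using cof[OF p] by blast
    obtain r where r: "(r, \<not> c) \<in> X" "le q r" using X2[OF q(1)] by blast
    then have "le p r" using q trans p XP by blast
    with q r show ?thesis by (cases "b = c") auto
  qed
  define C D where "C = {q. (q, True) \<in> X}" and "D = {q. (q, False) \<in> X}"
  have "C \<inter> D = {}"
    using X1 by (fastforce simp: C_def D_def)
  moreover have "C \<subseteq> P" "D \<subseteq> P"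
    using XP by (auto simp: C_def D_def)
  moreover have "\<forall>p\<in>P. \<exists>c\<in>C. le p c" "\<forall>p\<in>P. \<exists>d\<in>D. le p d"
    using cof' by (simp_all add: C_def D_def)
  ultimately show ?thesis by blast
qed

text \<open>Keep the points that precede, in a fixed well-order, everything else above them. The
  first element above \<open>p\<close> in the well-order is such a point, since whatever lies above
  it also lies above \<open>p\<close>. Among the points kept, going up in \<open>le\<close> means
  going up in \<open>w\<close>.\<close>

lemma ex_cofinal_ranked:
  fixes P :: "'a set" and le :: "'a \<Rightarrow> 'a \<Rightarrow> bool"
  assumes refl: "\<And>x. x \<in> P \<Longrightarrow> le x x"
    and trans: "\<And>x y z. x \<in> P \<Longrightarrow> y \<in> P \<Longrightarrow> z \<in> P \<Longrightarrow> le x y \<Longrightarrow> le y z \<Longrightarrow> le x z"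
  shows "\<exists>C w. C \<subseteq> P \<and> wf w \<and> (\<forall>p\<in>P. \<exists>c\<in>C. le p c) \<and>
    (\<forall>x\<in>C. \<forall>y\<in>C. le x y \<longrightarrow> x = y \<or> (x, y) \<in> w)"
proof -
  obtain r :: "'a rel" where r: "well_order_on UNIV r"
    using well_order_on by blast
  define w where "w = r - Id"
  have wf: "wf w" using r by (simp add: w_def well_order_on_def)
  have total: "x = y \<or> (x, y) \<in> w \<or> (y, x) \<in> w" for x y
    using r by (auto simp: w_def well_order_on_def linear_order_on_def total_on_def)
  define C where "C = {p\<in>P. \<forall>q\<in>P. le p q \<longrightarrow> p = q \<or> (p, q) \<in> w}"
  have "\<exists>c\<in>C. le p c" if p: "p \<in> P" for p
  proof -
    have "p \<in> {q\<in>P. le p q}" using p refl by blast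
    then obtain q where q: "q \<in> P" "le p q" "\<And>y. (y, q) \<in> w \<Longrightarrow> y \<notin> {q\<in>P. le p q}"
      using wfE_min[OF wf] by (metis (no_types, lifting) mem_Collect_eq)
    have "q \<in> C"
      using q total trans[OF p q(1)] unfolding C_def by blast
    with q show ?thesis by blast
  qed
  then show ?thesis
    using wf by (intro exI[of _ C] exI[of _ w]) (auto simp: C_def)
qed

text \<open>A maximal subspace \<open>W\<close> that misses \<open>v\<close> is a complement of the
  line through \<open>v\<close>, and the functional reads off the coefficient of \<open>v\<close>.
  If \<open>x\<close> is outside \<open>W\<close>, then adding \<open>x\<close> to \<open>W\<close>
  captures \<open>v\<close>, so v = w + c x with c nonzero, and this can be solved for
  \<open>x\<close>.\<close>

lemma ex_linear_functional:
  fixes R (structure) and M (structure)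
  assumes "field R" "module R M" and v: "v \<in> carrier M" "v \<noteq> \<zero>\<^bsub>M\<^esub>"
  shows "\<exists>f. (\<forall>x\<in>carrier M. f x \<in> carrier R) \<and>
    (\<forall>x\<in>carrier M. \<forall>y\<in>carrier M. f (x \<oplus>\<^bsub>M\<^esub> y) = f x \<oplus> f y) \<and>
    (\<forall>c\<in>carrier R. \<forall>x\<in>carrier M. f (c \<odot>\<^bsub>M\<^esub> x) = c \<otimes> f x) \<and> f v = \<one>"
proof -
  interpret R: field R by fact
  interpret module R M by fact
  define subspace where "subspace W \<longleftrightarrow> W \<subseteq> carrier M \<and> \<zero>\<^bsub>M\<^esub> \<in> W \<and>
    (\<forall>x\<in>W. \<forall>y\<in>W. x \<oplus>\<^bsub>M\<^esub> y \<in> W) \<and> (\<forall>c\<in>carrier R. \<forall>x\<in>W. c \<odot>\<^bsub>M\<^esub> x \<in> W)" for W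
  define A where "A = {W. subspace W \<and> v \<notin> W}"
  have "\<exists>M\<in>A. \<forall>X\<in>A. M \<subseteq> X \<longrightarrow> X = M"
  proof (rule subset_Zorn_nonempty)
    have "{\<zero>\<^bsub>M\<^esub>} \<in> A" using v by (auto simp: A_def subspace_def)
    then show "A \<noteq> {}" by blast
    fix C assume C: "C \<noteq> {}" "subset.chain A C"
    then have CA: "C \<subseteq> A" and ch: "\<And>X Y. X \<in> C \<Longrightarrow> Y \<in> C \<Longrightarrow> X \<subseteq> Y \<or> Y \<subseteq> X"
      by (auto simp: subset_chain_def)
    have sub: "subspace W" if "W \<in> C" for W
      using CA that by (auto simp: A_def)
    have "x \<oplus>\<^bsub>M\<^esub> y \<in> \<Union>C" if xy: "x \<in> \<Union>C" "y \<in> \<Union>C" for x y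
    proof -
      obtain X Y where "X \<in> C" "x \<in> X" "Y \<in> C" "y \<in> Y" using xy by blast
      then obtain Z where "Z \<in> C" "x \<in> Z" "y \<in> Z" using ch by blast
      with sub show ?thesis unfolding subspace_def by blast
    qed
    moreover have "c \<odot>\<^bsub>M\<^esub> x \<in> \<Union>C" if "c \<in> carrier R" "x \<in> \<Union>C" for c x
      using that sub unfolding subspace_def by blast
    moreover have "\<Union>C \<subseteq> carrier M" "\<zero>\<^bsub>M\<^esub> \<in> \<Union>C"
      using sub C(1) unfolding subspace_def by blast+
    ultimately have "subspace (\<Union>C)"
      unfolding subspace_def by blast
    moreover have "v \<notin> \<Union>C" using CA by (auto simp: A_def)
    ultimately show "\<Union>C \<in> A" by (simp add: A_def)
  qed
  then obtain W where "W \<in> A" and max: "\<And>X. X \<in> A \<Longrightarrow> W \<subseteq> X \<Longrightarrow> X = W" by blast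
  then have W: "subspace W" and vW: "v \<notin> W" by (auto simp: A_def)
  have W1: "x \<in> carrier M" if "x \<in> W" for x using W that by (auto simp: subspace_def)
  have W2: "x \<oplus>\<^bsub>M\<^esub> y \<in> W" if "x \<in> W" "y \<in> W" for x y using W that by (auto simp: subspace_def)
  have W3: "c \<odot>\<^bsub>M\<^esub> x \<in> W" if "c \<in> carrier R" "x \<in> W" for x c using W that by (auto simp: subspace_def)
  have W0: "\<zero>\<^bsub>M\<^esub> \<in> W" using W by (auto simp: subspace_def)
  have decomp: "\<exists>c\<in>carrier R. \<exists>w\<in>W. x = w \<oplus>\<^bsub>M\<^esub> c \<odot>\<^bsub>M\<^esub> v" if x: "x \<in> carrier M" for x
  proof (cases "x \<in> W")
    case True
    then have "x = x \<oplus>\<^bsub>M\<^esub> \<zero> \<odot>\<^bsub>M\<^esub> v" using v x by (simp add: smult_l_null)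
    with True show ?thesis by blast
  next
    case False
    define W' where "W' = {w \<oplus>\<^bsub>M\<^esub> c \<odot>\<^bsub>M\<^esub> x |w c. w \<in> W \<and> c \<in> carrier R}"
    have W'I: "w \<oplus>\<^bsub>M\<^esub> c \<odot>\<^bsub>M\<^esub> x \<in> W'" if "w \<in> W" "c \<in> carrier R" for w c
      using that by (auto simp: W'_def)
    have WW': "w \<in> W'" if "w \<in> W" for w
      using W'I[OF that, of \<zero>] x W1[OF that] by (simp add: smult_l_null)
    have xW': "x \<in> W'"
      using W'I[OF W0, of \<one>] x by simp
    have "subspace W'"
      unfolding subspace_def
    proof (intro conjI ballI)
      show "W' \<subseteq> carrier M" using W1 x by (auto simp: W'_def)
      show "\<zero>\<^bsub>M\<^esub> \<in> W'" by (rule WW'[OF W0])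
    next
      fix y z assume "y \<in> W'" "z \<in> W'"
      then obtain w c w' c' where *: "y = w \<oplus>\<^bsub>M\<^esub> c \<odot>\<^bsub>M\<^esub> x" "w \<in> W" "c \<in> carrier R"
        "z = w' \<oplus>\<^bsub>M\<^esub> c' \<odot>\<^bsub>M\<^esub> x" "w' \<in> W" "c' \<in> carrier R"
        by (auto simp: W'_def)
      then have "y \<oplus>\<^bsub>M\<^esub> z = (w \<oplus>\<^bsub>M\<^esub> w') \<oplus>\<^bsub>M\<^esub> (c \<oplus> c') \<odot>\<^bsub>M\<^esub> x"
        using x W1 by (simp add: smult_l_distr M.add.m_ac)
      then show "y \<oplus>\<^bsub>M\<^esub> z \<in> W'"
        using W'I[of "w \<oplus>\<^bsub>M\<^esub> w'" "c \<oplus> c'"] * W2 by simp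
    next
      fix d y assume d: "d \<in> carrier R" and "y \<in> W'"
      then obtain w c where *: "y = w \<oplus>\<^bsub>M\<^esub> c \<odot>\<^bsub>M\<^esub> x" "w \<in> W" "c \<in> carrier R"
        by (auto simp: W'_def)
      then have "d \<odot>\<^bsub>M\<^esub> y = d \<odot>\<^bsub>M\<^esub> w \<oplus>\<^bsub>M\<^esub> (d \<otimes> c) \<odot>\<^bsub>M\<^esub> x"
        using x d W1 by (simp add: smult_r_distr smult_assoc1)
      then show "d \<odot>\<^bsub>M\<^esub> y \<in> W'"
        using W'I[of "d \<odot>\<^bsub>M\<^esub> w" "d \<otimes> c"] * d W3 by simp
    qed
    moreover have "W' \<noteq> W" using xW' False by blast
    ultimately have "v \<in> W'"
      using max[of W'] WW' by (auto simp: A_def)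
    then obtain w c where *: "v = w \<oplus>\<^bsub>M\<^esub> c \<odot>\<^bsub>M\<^esub> x" "w \<in> W" "c \<in> carrier R"
      by (auto simp: W'_def)
    have "c \<noteq> \<zero>"
    proof
      assume "c = \<zero>"
      then have "v = w" using * x W1 by (simp add: smult_l_null)
      with vW *(2) show False by simp
    qed
    then have c: "inv c \<in> carrier R" "inv c \<otimes> c = \<one>"
      using * R.field_Units by auto
    have "inv c \<odot>\<^bsub>M\<^esub> v = inv c \<odot>\<^bsub>M\<^esub> w \<oplus>\<^bsub>M\<^esub> x"
      using * c x W1 by (simp add: smult_r_distr smult_assoc1[symmetric])
    then have "(\<ominus> (inv c)) \<odot>\<^bsub>M\<^esub> w \<oplus>\<^bsub>M\<^esub> inv c \<odot>\<^bsub>M\<^esub> v = x"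
      using * c x W1 by (simp add: smult_l_minus M.r_neg1)
    then show ?thesis
      using W3[of "\<ominus> (inv c)" w] * c by (metis R.a_inv_closed)
  qed
  have unique: "c = c'" if c: "c \<in> carrier R" "c' \<in> carrier R" and w: "w \<in> W" "w' \<in> W"
    and eq: "w \<oplus>\<^bsub>M\<^esub> c \<odot>\<^bsub>M\<^esub> v = w' \<oplus>\<^bsub>M\<^esub> c' \<odot>\<^bsub>M\<^esub> v" for c c' w w'
  proof (rule ccontr)
    assume "c \<noteq> c'"
    define d where "d = c \<ominus> c'"
    have "d \<oplus> c' = c"
      using c by (simp add: d_def R.minus_eq R.a_assoc R.l_neg)
    then have d: "d \<in> carrier R" "d \<noteq> \<zero>"
      using c \<open>c \<noteq> c'\<close> by (auto simp: d_def)
    have mw: "\<ominus>\<^bsub>M\<^esub> w = (\<ominus> \<one>) \<odot>\<^bsub>M\<^esub> w"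
      using w W1 by (simp add: smult_l_minus)
    have "d \<odot>\<^bsub>M\<^esub> v = c \<odot>\<^bsub>M\<^esub> v \<oplus>\<^bsub>M\<^esub> (\<ominus>\<^bsub>M\<^esub> (c' \<odot>\<^bsub>M\<^esub> v))"
      using c v by (simp add: d_def R.minus_eq smult_l_distr smult_l_minus)
    also have "c \<odot>\<^bsub>M\<^esub> v = \<ominus>\<^bsub>M\<^esub> w \<oplus>\<^bsub>M\<^esub> (w' \<oplus>\<^bsub>M\<^esub> c' \<odot>\<^bsub>M\<^esub> v)"
      using c v w W1 by (simp add: eq[symmetric] M.r_neg1)
    also have "(\<ominus>\<^bsub>M\<^esub> w \<oplus>\<^bsub>M\<^esub> (w' \<oplus>\<^bsub>M\<^esub> c' \<odot>\<^bsub>M\<^esub> v)) \<oplus>\<^bsub>M\<^esub> (\<ominus>\<^bsub>M\<^esub> (c' \<odot>\<^bsub>M\<^esub> v)) = \<ominus>\<^bsub>M\<^esub> w \<oplus>\<^bsub>M\<^esub> w'"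
      using c v w W1 by (simp add: M.add.m_assoc M.r_neg)
    finally have "d \<odot>\<^bsub>M\<^esub> v \<in> W"
      using W2 W3 w mw by simp
    then have "inv d \<odot>\<^bsub>M\<^esub> (d \<odot>\<^bsub>M\<^esub> v) \<in> W"
      using W3 d R.field_Units by simp
    moreover have "inv d \<odot>\<^bsub>M\<^esub> (d \<odot>\<^bsub>M\<^esub> v) = v"
      using d R.field_Units v by (simp add: smult_assoc1[symmetric])
    ultimately show False using vW by simp
  qed
  define f where "f x = (THE c. c \<in> carrier R \<and> (\<exists>w\<in>W. x = w \<oplus>\<^bsub>M\<^esub> c \<odot>\<^bsub>M\<^esub> v))" for x
  have f_eq: "f x = c" if "c \<in> carrier R" "w \<in> W" "x = w \<oplus>\<^bsub>M\<^esub> c \<odot>\<^bsub>M\<^esub> v" for x c w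
    unfolding f_def using that unique by (intro the_equality) blast+
  have "f x \<in> carrier R" if "x \<in> carrier M" for x
    using decomp[OF that] f_eq by metis
  moreover have "f (x \<oplus>\<^bsub>M\<^esub> y) = f x \<oplus> f y" if xy: "x \<in> carrier M" "y \<in> carrier M" for x y
  proof -
    obtain c w c' w' where *: "c \<in> carrier R" "w \<in> W" "x = w \<oplus>\<^bsub>M\<^esub> c \<odot>\<^bsub>M\<^esub> v"
      "c' \<in> carrier R" "w' \<in> W" "y = w' \<oplus>\<^bsub>M\<^esub> c' \<odot>\<^bsub>M\<^esub> v"
      using decomp xy by metis
    have "x \<oplus>\<^bsub>M\<^esub> y = (w \<oplus>\<^bsub>M\<^esub> w') \<oplus>\<^bsub>M\<^esub> (c \<oplus> c') \<odot>\<^bsub>M\<^esub> v"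
      using * v W1 by (simp add: smult_l_distr M.add.m_ac)
    from f_eq[OF _ _ this] f_eq * W2 show ?thesis by simp
  qed
  moreover have "f (d \<odot>\<^bsub>M\<^esub> x) = d \<otimes> f x" if dx: "d \<in> carrier R" "x \<in> carrier M" for d x
  proof -
    obtain c w where *: "c \<in> carrier R" "w \<in> W" "x = w \<oplus>\<^bsub>M\<^esub> c \<odot>\<^bsub>M\<^esub> v"
      using decomp dx by metis
    have "d \<odot>\<^bsub>M\<^esub> x = d \<odot>\<^bsub>M\<^esub> w \<oplus>\<^bsub>M\<^esub> (d \<otimes> c) \<odot>\<^bsub>M\<^esub> v"
      using * v dx W1 by (simp add: smult_r_distr smult_assoc1)
    from f_eq[OF _ _ this] f_eq * W3 dx show ?thesis by simp
  qed
  moreover have "f v = \<one>"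
    using f_eq[OF R.one_closed W0] v by simp
  ultimately show ?thesis by blast
qed

section \<open>Small classes in a ground universe\<close>

locale ground_universe = in_structure S for S :: "'v zfa_structure" +
  assumes ground: "ground"
begin

lemma ZFA: "ZFA"
  using ground by (simp add: ground_def)

lemma Atoms_subset: "Atoms S \<subseteq> Univ S"
  using ZFA unfolding ZFA_def by (elim conjE)

lemma elts_atom: "a \<in> Atoms S \<Longrightarrow> elts a = {}"
  using ZFA unfolding ZFA_def by (elim conjE) blast

lemma extensionality: "x \<in> sets \<Longrightarrow> y \<in> sets \<Longrightarrow> elts x = elts y \<Longrightarrow> x = y"
  using ZFA unfolding ZFA_def by (elim conjE) blast

lemma foundation: "x \<in> Univ S \<Longrightarrow> elts x \<noteq> {} \<Longrightarrow> \<exists>y\<in>elts x. elts y \<inter> elts x = {}"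
  using ZFA unfolding ZFA_def by (elim conjE) blast

lemma elts_subset_Univ: "elts x \<subseteq> Univ S"
  by (auto simp: elts_def)

lemma sets_subset_Univ: "sets \<subseteq> Univ S"
  by (auto simp: sets_def)

text \<open>With this notion the axioms turn into closure properties of HOL sets, so that later sets
  are given by HOL comprehension and not by formulas of the language.\<close>

definition small :: "'v set \<Rightarrow> bool" where
  "small X \<longleftrightarrow> (\<exists>x\<in>sets. elts x = X)"

lemma small_subset_Univ: "small X \<Longrightarrow> X \<subseteq> Univ S"
  using elts_subset_Univ by (auto simp: small_def)

lemma small_image:
  assumes "small X" "f ` X \<subseteq> Univ S"
  shows "small (f ` X)"
  using ground assms sets_subset_Univ unfolding ground_def small_def by blast

lemma ex_inductive: "\<exists>I\<in>Univ S. inductive_in I"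
  using ZFA unfolding ZFA_def by (elim conjE)

lemma small_empty: "small {}"
  using ex_inductive unfolding inductive_in_def is_empty_def small_def by blast

lemma small_subset:
  assumes "small X" "Y \<subseteq> X"
  shows "small Y"
proof (cases "Y = {}")
  case False
  then obtain y where y: "y \<in> Y" by blast
  \<comment> \<open>Separation is obtained from replacement: points outside \<open>Y\<close> are
    sent to a fixed element of \<open>Y\<close>, so that the image is exactly
    \<open>Y\<close>.\<close>
  define f where "f = (\<lambda>x. if x \<in> Y then x else y)"
  have "f ` X = Y"
    using y assms(2) by (auto simp: f_def)
  then show ?thesis
    using small_image[of X f] small_subset_Univ[OF assms(1)] assms by auto
qed (simp add: small_empty)

lemma small_elts: "x \<in> Univ S \<Longrightarrow> small (elts x)"
  using elts_atom small_empty by (cases "x \<in> Atoms S") (auto simp: small_def sets_def)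

lemma small_Atoms: "small (Atoms S)"
  using ZFA unfolding ZFA_def small_def by (elim conjE)

lemma small_pair: "x \<in> Univ S \<Longrightarrow> y \<in> Univ S \<Longrightarrow> small {x, y}"
  using ZFA unfolding ZFA_def small_def by (elim conjE) blast

lemma small_Pow:
  assumes "small X"
  shows "small {y \<in> sets. elts y \<subseteq> X}"
proof -
  have "\<forall>x\<in>sets. \<exists>p\<in>sets. elts p = {y \<in> sets. elts y \<subseteq> elts x}"
    using ZFA unfolding ZFA_def by (elim conjE)
  then show ?thesis
    using assms by (auto simp: small_def)
qed

lemma small_Union_elts: "small X \<Longrightarrow> small (\<Union>x\<in>X. elts x)"
proof -
  assume "small X"
  then obtain x where "x \<in> sets" "elts x = X"
    by (auto simp: small_def)
  moreover have "\<forall>x\<in>Univ S. \<exists>u\<in>sets. elts u = (\<Union>y\<in>elts x. elts y)"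
    using ZFA unfolding ZFA_def by (elim conjE)
  ultimately show ?thesis
    using sets_subset_Univ unfolding small_def by blast
qed

definition set_of :: "'v set \<Rightarrow> 'v" where
  "set_of X = (THE x. x \<in> sets \<and> elts x = X)"

lemma
  assumes "small X"
  shows set_of_in_sets: "set_of X \<in> sets" and elts_set_of: "elts (set_of X) = X"
proof -
  have "\<exists>!x. x \<in> sets \<and> elts x = X"
    using assms extensionality by (auto simp: small_def)
  from theI'[OF this] show "set_of X \<in> sets" "elts (set_of X) = X"
    by (auto simp: set_of_def)
qed

lemma small_UN:
  assumes "small I" "\<And>i. i \<in> I \<Longrightarrow> small (F i)"
  shows "small (\<Union>i\<in>I. F i)"
proof -
  have "small ((\<lambda>i. set_of (F i)) ` I)"
    using assms sets_subset_Univ set_of_in_sets by (intro small_image) auto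
  from small_Union_elts[OF this] show ?thesis
    using assms elts_set_of by simp
qed

lemma small_Un:
  assumes "small X" "small Y"
  shows "small (X \<union> Y)"
  using small_Union_elts[OF small_pair[of "set_of X" "set_of Y"]] assms
    set_of_in_sets elts_set_of sets_subset_Univ by auto

lemma small_insert: "x \<in> Univ S \<Longrightarrow> small X \<Longrightarrow> small (insert x X)"
  using small_Un[of "{x, x}" X] small_pair[of x x] by simp

lemma not_mem_self: "x \<in> Univ S \<Longrightarrow> x \<notin> elts x"
proof
  assume x: "x \<in> Univ S" "x \<in> elts x"
  have s: "small {x}"
    using small_pair[of x x] x by simp
  from foundation[of "set_of {x}"] show False
    using elts_set_of[OF s] set_of_in_sets[OF s] sets_subset_Univ x by auto
qed

section \<open>Von Neumann numerals and countable sets of the ground universe\<close>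

primrec num :: "nat \<Rightarrow> 'v" where
  "num 0 = set_of {}"
| "num (Suc n) = set_of (insert (num n) (elts (num n)))"

lemma num_in_sets: "num n \<in> sets"
proof (induction n)
  case (Suc n)
  then have "num n \<in> Univ S" using sets_subset_Univ by blast
  then show ?case
    by (simp add: set_of_in_sets small_insert small_elts)
qed (simp add: set_of_in_sets small_empty)

lemma num_in_Univ: "num n \<in> Univ S"
  using num_in_sets sets_subset_Univ by blast

lemma elts_num_Suc: "elts (num (Suc n)) = insert (num n) (elts (num n))"
  by (simp add: elts_set_of small_insert small_elts num_in_Univ)

lemma elts_num: "elts (num n) = num ` {..<n}"
proof (induction n)
  case (Suc n)
  then show ?case
    by (simp add: elts_num_Suc lessThan_Suc del: num.simps)
qed (simp add: elts_set_of small_empty)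

lemma num_neq: "m < n \<Longrightarrow> num m \<noteq> num n"
  using not_mem_self[OF num_in_Univ, of n] by (metis elts_num imageI lessThan_iff)

lemma inj_num: "inj num"
  by (metis injI nat_neq_iff num_neq)

declare num.simps [simp del]

lemma small_range_num: "small (range num)"
proof -
  obtain I where I: "I \<in> Univ S" "inductive_in I"
    using ex_inductive by blast
  have "num n \<in> elts I" for n
  proof (induction n)
    case 0
    obtain z where z: "z \<in> elts I" "is_empty z"
      using I by (auto simp: inductive_in_def)
    then have "z = num 0"
      using extensionality[of z "num 0"] num_in_sets[of 0] elts_num[of 0] by (simp add: is_empty_def)
    then show ?case using z by simp
  next
    case (Suc n)
    obtain z where z: "z \<in> elts I" "is_succ z (num n)"
      using I Suc by (auto simp: inductive_in_def)
    then have "z = num (Suc n)"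
      using extensionality[of z "num (Suc n)"] num_in_sets[of "Suc n"] elts_num_Suc[of n]
      by (simp add: is_succ_def)
    then show ?case using z by simp
  qed
  then show ?thesis
    using small_subset[OF small_elts[OF I(1)]] by blast
qed

text \<open>The numerals form a set, and \<open>ground\<close> grants replacement along arbitrary
  HOL functions. So sequences built by recursion or choice in the metalogic have ranges that are
  sets, definable or not.\<close>

lemma small_range:
  fixes f :: "nat \<Rightarrow> 'v"
  assumes "range f \<subseteq> Univ S"
  shows "small (range f)"
proof -
  have eq: "(\<lambda>x. f (inv_into UNIV num x)) ` range num = range f"
    by (simp add: image_image inj_num)
  show ?thesis
    by (rule small_image[OF small_range_num, of "\<lambda>x. f (inv_into UNIV num x)", unfolded eq, OF assms])
qed

text \<open>Foundation only speaks about sets; it applies to arbitrary predicates because transitive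
  closures are small.\<close>

lemma wf_mem_rel: "wf mem_rel"
proof (rule wfI_min)
  fix q :: 'v and Q assume q: "q \<in> Q"
  show "\<exists>z\<in>Q. \<forall>y. (y, z) \<in> mem_rel \<longrightarrow> y \<notin> Q"
  proof (cases "q \<in> Univ S")
    case True
    define t where "t = rec_nat {q} (\<lambda>_ X. \<Union>x\<in>X. elts x)"
    have t_Suc: "t (Suc n) = (\<Union>x\<in>t n. elts x)" for n
      by (simp add: t_def)
    have t: "small (t n)" for n
    proof (induction n)
      case 0
      then show ?case using small_pair[of q q] True by (simp add: t_def)
    next
      case (Suc n)
      then show ?case by (simp add: t_Suc small_Union_elts)
    qed
    define X where "X = (\<Union>n. t n)"
    have "small (range (\<lambda>n. set_of (t n)))"
      using t set_of_in_sets sets_subset_Univ by (intro small_range) auto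
    from small_Union_elts[OF this] have "small X"
      using t elts_set_of by (simp add: X_def)
    then have s: "small (X \<inter> Q)"
      by (rule small_subset) simp
    have "q \<in> t 0"
      by (simp add: t_def)
    then have "q \<in> X \<inter> Q"
      using q by (auto simp: X_def)
    moreover have "set_of (X \<inter> Q) \<in> Univ S"
      using set_of_in_sets[OF s] sets_subset_Univ by blast
    ultimately obtain y where y: "y \<in> X" "y \<in> Q" "elts y \<inter> (X \<inter> Q) = {}"
      using foundation[of "set_of (X \<inter> Q)"] unfolding elts_set_of[OF s] by blast
    from y(1) obtain n where "y \<in> t n" by (auto simp: X_def)
    then have "elts y \<subseteq> t (Suc n)" by (auto simp: t_Suc)
    then have "elts y \<subseteq> X" by (auto simp: X_def)
    then show ?thesis
      using y unfolding mem_rel_def by blast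
  next
    case False
    then show ?thesis
      using q unfolding mem_rel_def by blast
  qed
qed

end

section \<open>Adding atoms\<close>

locale atomless_universe = ground_universe S for S :: "'v zfa_structure" +
  assumes Atoms_empty: "Atoms S = {}"
begin

lemma sets_eq_Univ: "sets = Univ S"
  by (simp add: sets_def Atoms_empty)

text \<open>\<open>collapse x\<close> is the old set whose elements become the elements of
  \<open>x\<close>. Restricted to the new sets it is a bijection onto the universe, and this carries
  extensionality and the existence of sets over to the new structure.\<close>

definition collapse :: "'v \<Rightarrow> 'v" where
  "collapse x = (if x \<in> range num
     then let n = inv_into UNIV num x in num (if even n then 0 else n div 2) else x)"

text \<open>The even numerals lose their elements and become atoms, and the odd numeral \<open>2 n + 1\<close>
  takes over the role of \<open>n\<close>. As the new membership relation is contained in the old one, it is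
  still well-founded.\<close>

definition with_atoms :: "'v zfa_structure" where
  "with_atoms = \<lparr>Univ = Univ S, Mem = (\<lambda>y x. y \<in> elts (collapse x)), Atoms = num ` {n. even n}\<rparr>"

lemma collapse_num: "collapse (num n) = num (if even n then 0 else n div 2)"
  by (simp add: collapse_def inj_num)

lemma collapse_not_num: "x \<notin> range num \<Longrightarrow> collapse x = x"
  by (simp add: collapse_def)

lemma collapse_in_Univ: "x \<in> Univ S \<Longrightarrow> collapse x \<in> Univ S"
  using num_in_Univ by (cases "x \<in> range num") (auto simp: collapse_num collapse_not_num)

lemma elts_collapse_subset: "elts (collapse x) \<subseteq> elts x"
  by (cases "x \<in> range num") (auto simp: collapse_num collapse_not_num elts_num split: if_splits)

lemma inj_on_collapse: "inj_on collapse (Univ S - num ` {n. even n})"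
proof (rule inj_onI)
  fix x y assume x: "x \<in> Univ S - num ` {n. even n}" and y: "y \<in> Univ S - num ` {n. even n}"
    and eq: "collapse x = collapse y"
  show "x = y"
  proof (cases "x \<in> range num")
    case True
    then obtain m where m: "x = num m" by auto
    with x have "odd m" by auto
    have "y \<in> range num"
      using eq by (metis m collapse_num collapse_not_num rangeI)
    then obtain n where n: "y = num n" by auto
    with y have "odd n" by auto
    with \<open>odd m\<close> eq show ?thesis
      by (auto simp: m n collapse_num inj_eq[OF inj_num] elim!: oddE)
  next
    case False
    have "y \<notin> range num"
      using eq False by (metis collapse_num collapse_not_num rangeI rangeE)
    then show ?thesis
      using eq False by (simp add: collapse_not_num)
  qed
qed

lemma surj_collapse:
  assumes "x \<in> Univ S"
  obtains y where "y \<in> Univ S - num ` {n. even n}" "collapse y = x"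
proof (cases "x \<in> range num")
  case True
  then obtain m where m: "x = num m" by auto
  have "num (2 * m + 1) \<notin> num ` {n. even n}"
    by (auto simp: inj_eq[OF inj_num])
  moreover have "collapse (num (2 * m + 1)) = x"
    by (simp add: collapse_num m)
  ultimately show ?thesis
    using that num_in_Univ by blast
next
  case False
  then show ?thesis
    using that[of x] assms by (auto simp: collapse_not_num)
qed

interpretation A: in_structure with_atoms .

lemma with_atoms_simps: "Univ with_atoms = Univ S" "Atoms with_atoms = num ` {n. even n}"
    "Mem with_atoms y x \<longleftrightarrow> y \<in> elts (collapse x)"
  by (simp_all add: with_atoms_def)

lemma A_sets: "A.sets = Univ S - num ` {n. even n}"
  by (simp add: A.sets_def with_atoms_simps)

lemma A_elts: "A.elts x = elts (collapse x)"
  using elts_subset_Univ[of "collapse x"] by (auto simp: A.elts_def with_atoms_simps)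

text \<open>Together with \<open>A_small\<close> this shows that the new structure has the same
  small classes as the old one, so the closure properties proved for \<open>small\<close> yield its
  axioms.\<close>

lemma A_sets_ex:
  assumes "small X"
  shows "\<exists>x\<in>A.sets. A.elts x = X"
proof -
  obtain x where x: "x \<in> sets" "elts x = X"
    using assms by (auto simp: small_def)
  then have "x \<in> Univ S" using sets_subset_Univ by blast
  then obtain y where "y \<in> Univ S - num ` {n. even n}" "collapse y = x"
    by (rule surj_collapse)
  then show ?thesis
    using x by (auto simp: A_sets A_elts)
qed

lemma A_small: "x \<in> Univ S \<Longrightarrow> small (A.elts x)"
  by (simp add: A_elts small_elts collapse_in_Univ)

lemma A_elts_subset_Univ: "A.elts x \<subseteq> Univ S"
  by (simp add: A_elts elts_subset_Univ)

lemma A_ex_inductive: "\<exists>I\<in>Univ S. A.inductive_in I"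
proof -
  define code where "code X = (SOME x. x \<in> A.sets \<and> A.elts x = X)" for X
  have code: "code X \<in> A.sets" "A.elts (code X) = X" if "small X" for X
    using someI_ex[of "\<lambda>x. x \<in> A.sets \<and> A.elts x = X"] A_sets_ex[OF that] by (auto simp: code_def)
  \<comment> \<open>The old numerals have partly become atoms, so the von Neumann numerals are built
    afresh with the new membership.\<close>
  define g where "g = rec_nat (code {}) (\<lambda>_ x. code (insert x (A.elts x)))"
  have g_0: "g 0 = code {}" and g_Suc: "g (Suc n) = code (insert (g n) (A.elts (g n)))" for n
    by (simp_all add: g_def)
  have g: "g n \<in> A.sets" for n
  proof (induction n)
    case 0
    then show ?case by (simp add: g_0 code small_empty)
  next
    case (Suc n)
    then have "g n \<in> Univ S" by (simp add: A_sets)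
    then show ?case
      by (simp add: g_Suc code small_insert A_small)
  qed
  then have gU: "g n \<in> Univ S" for n
    by (simp add: A_sets)
  then have "small (range g)"
    by (intro small_range) auto
  then have I: "code (range g) \<in> A.sets" "A.elts (code (range g)) = range g"
    using code by auto
  have "A.is_empty (g 0)"
    using code[OF small_empty] by (simp add: g_0 A.is_empty_def)
  moreover have "A.is_succ (g (Suc n)) (g n)" for n
    using code[of "insert (g n) (A.elts (g n))"] gU
    by (simp add: g_Suc A.is_succ_def small_insert A_small)
  ultimately have "A.inductive_in (code (range g))"
    unfolding A.inductive_in_def I(2) using I(1) by auto
  then show ?thesis
    using I by (auto simp: A_sets)
qed

text \<open>Formulas need no analysis here: satisfaction in the new structure is just some HOL
  predicate, and replacement in \<open>ground\<close> covers all of these.\<close>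

lemma A_replacement: A.replacement_schema
  unfolding A.replacement_schema_def with_atoms_simps
proof (intro allI ballI impI, elim conjE)
  fix \<phi> e x
  assume x: "x \<in> Univ S"
    and fn: "\<forall>u\<in>A.elts x. \<forall>v\<in>Univ S. \<forall>w\<in>Univ S.
      A.sat \<phi> (e(0 := u, 1 := v)) \<and> A.sat \<phi> (e(0 := u, 1 := w)) \<longrightarrow> v = w"
  define D where "D = {u \<in> A.elts x. \<exists>v\<in>Univ S. A.sat \<phi> (e(0 := u, 1 := v))}"
  define h where "h u = (SOME v. v \<in> Univ S \<and> A.sat \<phi> (e(0 := u, 1 := v)))" for u
  have h: "h u \<in> Univ S \<and> A.sat \<phi> (e(0 := u, 1 := h u))" if "u \<in> D" for u
    unfolding h_def by (rule someI_ex) (use that in \<open>auto simp: D_def\<close>)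
  have "small D"
    using small_subset[OF A_small[OF x]] by (simp add: D_def)
  then have "small (h ` D)"
    using h by (intro small_image) auto
  moreover have "h ` D = {v \<in> Univ S. \<exists>u\<in>A.elts x. A.sat \<phi> (e(0 := u, 1 := v))}"
  proof (intro equalityI subsetI)
    fix v assume "v \<in> h ` D"
    then show "v \<in> {v \<in> Univ S. \<exists>u\<in>A.elts x. A.sat \<phi> (e(0 := u, 1 := v))}"
      using h by (auto simp: D_def)
  next
    fix v assume "v \<in> {v \<in> Univ S. \<exists>u\<in>A.elts x. A.sat \<phi> (e(0 := u, 1 := v))}"
    then obtain u where u: "v \<in> Univ S" "u \<in> A.elts x" "A.sat \<phi> (e(0 := u, 1 := v))"
      by blast
    then have "u \<in> D" by (auto simp: D_def)
    with h[OF this] fn u have "v = h u" by blast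
    with \<open>u \<in> D\<close> show "v \<in> h ` D" by blast
  qed
  ultimately show "\<exists>y\<in>A.sets. A.elts y = {v \<in> Univ S. \<exists>u\<in>A.elts x. A.sat \<phi> (e(0 := u, 1 := v))}"
    using A_sets_ex by simp
qed

lemma A_ZFA: A.ZFA
proof -
  have "\<forall>a\<in>num ` {n. even n}. A.elts a = {}"
    using elts_num[of 0] by (auto simp: A_elts collapse_num)
  moreover have "\<exists>A\<in>A.sets. A.elts A = num ` {n. even n}"
    by (intro A_sets_ex small_subset[OF small_range_num]) auto
  moreover have "\<forall>x\<in>A.sets. \<forall>y\<in>A.sets. A.elts x = A.elts y \<longrightarrow> x = y"
  proof (intro ballI impI)
    fix x y assume "x \<in> A.sets" "y \<in> A.sets" "A.elts x = A.elts y"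
    moreover from this have "collapse x = collapse y"
      using extensionality collapse_in_Univ
      by (auto simp: A_sets A_elts sets_eq_Univ)
    ultimately show "x = y"
      using inj_on_collapse by (auto simp: inj_on_def A_sets)
  qed
  moreover have "\<forall>x\<in>Univ S. A.elts x \<noteq> {} \<longrightarrow> (\<exists>y\<in>A.elts x. A.elts y \<inter> A.elts x = {})"
  proof (intro ballI impI)
    fix x assume "A.elts x \<noteq> {}"
    then obtain y where y: "y \<in> A.elts x" "\<And>z. (z, y) \<in> mem_rel \<Longrightarrow> z \<notin> A.elts x"
      using wfE_min[OF wf_mem_rel] by (metis ex_in_conv)
    then have "elts y \<inter> A.elts x = {}"
      using A_elts_subset_Univ by (auto simp: mem_rel_def)
    then have "A.elts y \<inter> A.elts x = {}"
      using elts_collapse_subset[of y] unfolding A_elts by blast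
    then show "\<exists>y\<in>A.elts x. A.elts y \<inter> A.elts x = {}"
      using y(1) by blast
  qed
  moreover have "\<forall>x\<in>Univ S. \<forall>y\<in>Univ S. \<exists>z\<in>A.sets. A.elts z = {x, y}"
    using A_sets_ex small_pair by simp
  moreover have "\<forall>x\<in>Univ S. \<exists>u\<in>A.sets. A.elts u = (\<Union>y\<in>A.elts x. A.elts y)"
    by (intro ballI A_sets_ex small_UN A_small) (use A_elts_subset_Univ in auto)
  moreover have "\<forall>x\<in>A.sets. \<exists>p\<in>A.sets. A.elts p = {y \<in> A.sets. A.elts y \<subseteq> A.elts x}"
  proof
    fix x assume "x \<in> A.sets"
    then have "small {y \<in> sets. elts y \<subseteq> A.elts x}"
      by (intro small_Pow A_small) (simp add: A_sets)
    moreover have "inj_on collapse A.sets"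
      using inj_on_collapse by (simp add: A_sets)
    \<comment> \<open>An inverse of \<open>collapse\<close> on the new sets, by which the old power
      set is mapped onto a class containing the new one. The default \<open>num 0\<close> only keeps
      the values inside the universe.\<close>
    define g where "g y = (if y \<in> collapse ` A.sets then inv_into A.sets collapse y else num 0)" for y
    have "g y \<in> Univ S" for y
      using inv_into_into[of y collapse A.sets] num_in_Univ by (auto simp: g_def A_sets)
    ultimately have "small (g ` {y \<in> sets. elts y \<subseteq> A.elts x})"
      by (intro small_image) auto
    moreover have "{y \<in> A.sets. A.elts y \<subseteq> A.elts x} \<subseteq> g ` {y \<in> sets. elts y \<subseteq> A.elts x}"
    proof
      fix y assume y: "y \<in> {y \<in> A.sets. A.elts y \<subseteq> A.elts x}"
      then have g: "g (collapse y) = y"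
        using \<open>inj_on collapse A.sets\<close> by (simp add: g_def)
      have "collapse y \<in> {y \<in> sets. elts y \<subseteq> A.elts x}"
        using y collapse_in_Univ by (simp add: A_sets A_elts sets_eq_Univ)
      from imageI[OF this, of g] show "y \<in> g ` {y \<in> sets. elts y \<subseteq> A.elts x}"
        unfolding g .
    qed
    ultimately show "\<exists>p\<in>A.sets. A.elts p = {y \<in> A.sets. A.elts y \<subseteq> A.elts x}"
      by (intro A_sets_ex) (rule small_subset)
  qed
  moreover have "num ` {n. even n} \<subseteq> Univ S"
    using num_in_Univ by blast
  moreover note A_replacement A_ex_inductive
  ultimately show ?thesis
    unfolding A.ZFA_def with_atoms_simps by - (intro conjI; assumption)
qed

text \<open>The selection is made by Hilbert choice in the metalogic; replacement for HOL functions
  turns its range into a set.\<close>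

lemma A_choice: A.choice
  unfolding A.choice_def with_atoms_simps
proof (intro ballI impI, elim conjE)
  fix X
  assume X: "X \<in> Univ S" and ne: "\<forall>x\<in>A.elts X. A.elts x \<noteq> {}"
    and disj: "\<forall>x\<in>A.elts X. \<forall>y\<in>A.elts X. x \<noteq> y \<longrightarrow> A.elts x \<inter> A.elts y = {}"
  define f where "f x = (SOME y. y \<in> A.elts x)" for x
  have f: "f x \<in> A.elts x" if "x \<in> A.elts X" for x
    using ne that by (simp add: f_def some_in_eq)
  have "small (f ` A.elts X)"
    using f A_elts_subset_Univ by (intro small_image A_small X) auto
  then obtain c where c: "c \<in> A.sets" "A.elts c = f ` A.elts X"
    using A_sets_ex by blast
  have "\<exists>!y. y \<in> A.elts c \<inter> A.elts x" if "x \<in> A.elts X" for x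
  proof (rule ex1I[of _ "f x"])
    show "f x \<in> A.elts c \<inter> A.elts x"
      using f that unfolding c(2) by auto
  next
    fix y assume "y \<in> A.elts c \<inter> A.elts x"
    then obtain z where z: "z \<in> A.elts X" "y = f z" "y \<in> A.elts x"
      unfolding c(2) by auto
    with f[OF z(1)] disj that have "z = x" by blast
    with z show "y = f x" by simp
  qed
  then show "\<exists>c\<in>A.sets. \<forall>x\<in>A.elts X. \<exists>!y. y \<in> A.elts c \<inter> A.elts x"
    using c by blast
qed

lemma A_ground: A.ground
  unfolding A.ground_def
  using A_ZFA A_choice A_sets_ex small_image A_small by (simp add: with_atoms_simps)

end

lemma ex_ground_with_atoms:
  fixes U :: "'v zfa_structure"
  assumes "in_structure.ground U" "Atoms U = {}"
  obtains S :: "'v zfa_structure" and at :: "nat \<Rightarrow> 'v"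
  where "in_structure.ground S" "bij_betw at UNIV (Atoms S)"
proof -
  interpret atomless_universe U
    by unfold_locales fact+
  have "bij_betw (\<lambda>n. num (2 * n)) UNIV (Atoms with_atoms)"
    unfolding bij_betw_def with_atoms_simps
    by (auto intro!: injI simp: inj_eq[OF inj_num] elim!: evenE)
  with A_ground that show ?thesis by blast
qed

section \<open>The group and the hereditarily symmetric sets\<close>

text \<open>The Klein four-group acts regularly on \<open>bool \<times> bool\<close>; one copy of it for every block
  \<open>{n} \<times> bool \<times> bool\<close> of atoms gives a group in which every element is an involution.\<close>

definition shift :: "(nat \<Rightarrow> bool \<times> bool) \<Rightarrow> nat \<times> bool \<times> bool \<Rightarrow> nat \<times> bool \<times> bool" where
  "shift s i = (fst i, fst (snd i) \<noteq> fst (s (fst i)), snd (snd i) \<noteq> snd (s (fst i)))"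

definition add_shifts :: "(nat \<Rightarrow> bool \<times> bool) \<Rightarrow> (nat \<Rightarrow> bool \<times> bool) \<Rightarrow> nat \<Rightarrow> bool \<times> bool" where
  "add_shifts s t n = (fst (s n) \<noteq> fst (t n), snd (s n) \<noteq> snd (t n))"

text \<open>In coordinates, the pointwise stabilizer of the first \<open>m\<close> blocks. These
  subgroups form a base of the filter, and \<open>m\<close> plays the role of a support.\<close>

definition fix_blocks :: "nat \<Rightarrow> (nat \<Rightarrow> bool \<times> bool) set" where
  "fix_blocks m = {s. \<forall>n<m. s n = (False, False)}"

lemma shift_add: "shift (add_shifts s t) i = shift s (shift t i)"
  by (auto simp: shift_def add_shifts_def)

lemma shift_zero: "shift (\<lambda>_. (False, False)) i = i"
  by (simp add: shift_def)

lemma add_shifts_commute: "add_shifts s t = add_shifts t s"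
  by (auto simp: add_shifts_def fun_eq_iff)

lemma add_shifts_self: "add_shifts s s = (\<lambda>_. (False, False))"
  by (simp add: add_shifts_def fun_eq_iff)

lemma fix_blocks_mono: "s \<in> fix_blocks n \<Longrightarrow> m \<le> n \<Longrightarrow> s \<in> fix_blocks m"
  by (simp add: fix_blocks_def)

locale klein_universe = ground_universe S for S :: "'v zfa_structure" +
  fixes at :: "nat \<times> bool \<times> bool \<Rightarrow> 'v"
  assumes bij_at: "bij_betw at UNIV (Atoms S)"
begin

text \<open>Restricted to the atoms because the elements of \<open>BijGroup\<close> are extensional
  functions.\<close>

definition perm :: "(nat \<Rightarrow> bool \<times> bool) \<Rightarrow> 'v \<Rightarrow> 'v" where
  "perm s = (\<lambda>a\<in>Atoms S. at (shift s (inv_into UNIV at a)))"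

lemma at_Atoms: "at i \<in> Atoms S"
  using bij_at by (auto simp: bij_betw_def)

lemma atomE: assumes "a \<in> Atoms S" obtains i where "a = at i"
  using assms bij_at unfolding bij_betw_def by blast

lemma at_Univ: "at i \<in> Univ S"
  using Atoms_subset at_Atoms by blast

lemma perm_at: "perm s (at i) = at (shift s i)"
  using bij_at at_Atoms by (simp add: perm_def bij_betw_def)

lemma perm_extensional: "perm s \<in> extensional (Atoms S)"
  by (simp add: perm_def)

lemma perm_eqI: "f \<in> extensional (Atoms S) \<Longrightarrow> (\<And>i. f (at i) = at (shift s i)) \<Longrightarrow> f = perm s"
  by (rule extensionalityI[OF _ perm_extensional]) (auto elim!: atomE simp: perm_at)

lemma perm_Bij: "perm s \<in> Bij (Atoms S)"
proof -
  have "perm s (perm s a) = a" "perm s a \<in> Atoms S" if "a \<in> Atoms S" for a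
    using that by (auto elim!: atomE simp: perm_at at_Atoms shift_add[symmetric] add_shifts_self shift_zero)
  then have "bij_betw (perm s) (Atoms S) (Atoms S)"
    by (intro bij_betw_byWitness[of _ "perm s"]) auto
  then show ?thesis
    by (simp add: Bij_def perm_extensional)
qed

abbreviation "B \<equiv> BijGroup (Atoms S)"

lemma perm_carrier: "perm s \<in> carrier B"
  by (simp add: BijGroup_def perm_Bij)

lemma perm_mult: "perm s \<otimes>\<^bsub>B\<^esub> perm t = perm (add_shifts s t)"
  by (rule perm_eqI)
    (simp_all add: BijGroup_def perm_Bij compose_def at_Atoms perm_at shift_add)

lemma perm_zero: "perm (\<lambda>_. (False, False)) = \<one>\<^bsub>B\<^esub>"
  by (rule perm_eqI[symmetric]) (simp_all add: BijGroup_def at_Atoms shift_zero)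

lemma perm_inv: "inv\<^bsub>B\<^esub> perm s = perm s"
proof -
  interpret group B by (rule group_BijGroup)
  show ?thesis
    by (rule inv_equality) (simp_all add: perm_mult add_shifts_self perm_zero perm_carrier)
qed

lemma act_eq:
  assumes "x \<in> Univ S"
  shows "act \<pi> x = (if x \<in> Atoms S then \<pi> x else set_of (act \<pi> ` elts x))"
proof -
  have "cut (act \<pi>) mem_rel x ` elts x = act \<pi> ` elts x"
    using assms by (intro image_cong refl cut_apply) (simp add: mem_rel_def)
  then show ?thesis
    using wfrec[OF wf_mem_rel, of "\<lambda>\<phi> x. if x \<in> Atoms S then \<pi> x
      else (THE z. z \<in> sets \<and> elts z = \<phi> ` elts x)" x]
    by (simp add: act_def[symmetric] set_of_def)
qed

definition T :: "(nat \<Rightarrow> bool \<times> bool) \<Rightarrow> 'v \<Rightarrow> 'v" where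
  "T s = act (perm s)"

lemma T_at: "T s (at i) = at (shift s i)"
  by (simp add: T_def act_eq perm_at at_Univ at_Atoms)

lemma T_set_of: "x \<in> sets \<Longrightarrow> T s x = set_of (T s ` elts x)"
  by (simp add: T_def act_eq sets_def)

lemma Univ_induct [consumes 1, case_names atom set]:
  assumes "x \<in> Univ S" "\<And>i. P (at i)"
    "\<And>x. x \<in> sets \<Longrightarrow> (\<And>y. y \<in> elts x \<Longrightarrow> P y) \<Longrightarrow> P x"
  shows "P x"
  using wf_mem_rel assms(1)
proof (induction x rule: wf_induct_rule)
  case (less x)
  show ?case
  proof (cases "x \<in> Atoms S")
    case True
    then show ?thesis using assms(2) by (auto elim: atomE)
  next
    case False
    have "P y" if "y \<in> elts x" for y
      using less.IH[of y] less.prems that elts_subset_Univ[of x] by (auto simp: mem_rel_def)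
    with False show ?thesis
      using assms(3) less.prems by (simp add: sets_def)
  qed
qed

lemma T_Univ: "x \<in> Univ S \<Longrightarrow> T s x \<in> Univ S"
proof (induction x rule: Univ_induct)
  case (atom i)
  then show ?case by (simp add: T_at at_Univ)
next
  case (set x)
  then have "small (T s ` elts x)"
    using sets_subset_Univ by (intro small_image small_elts) auto
  then show ?case
    using set_of_in_sets sets_subset_Univ by (auto simp: T_set_of set)
qed

lemma
  assumes "x \<in> sets"
  shows T_sets: "T s x \<in> sets" and elts_T_set: "elts (T s x) = T s ` elts x"
proof -
  have "small (T s ` elts x)"
    using assms sets_subset_Univ T_Univ elts_subset_Univ
    by (intro small_image small_elts) blast+
  then show "T s x \<in> sets" "elts (T s x) = T s ` elts x"
    using assms by (simp_all add: T_set_of set_of_in_sets elts_set_of)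
qed

lemma elts_T: "x \<in> Univ S \<Longrightarrow> elts (T s x) = T s ` elts x"
  by (cases "x \<in> Atoms S") (auto elim!: atomE simp: elts_T_set sets_def T_at elts_atom[OF at_Atoms])

lemma T_add: "x \<in> Univ S \<Longrightarrow> T (add_shifts s t) x = T s (T t x)"
proof (induction x rule: Univ_induct)
  case (set x)
  then show ?case
    by (intro extensionality T_sets) (auto simp: elts_T_set T_sets image_image)
qed (simp add: T_at shift_add)

lemma T_zero: "x \<in> Univ S \<Longrightarrow> T (\<lambda>_. (False, False)) x = x"
proof (induction x rule: Univ_induct)
  case (set x)
  then show ?case
    by (intro extensionality T_sets) (auto simp: elts_T_set)
qed (simp add: T_at shift_zero)

lemma T_T: "x \<in> Univ S \<Longrightarrow> T s (T s x) = x"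
  by (simp add: T_add[symmetric] add_shifts_self T_zero)

lemma T_commute: "x \<in> Univ S \<Longrightarrow> T s (T t x) = T t (T s x)"
  by (metis T_add add_shifts_commute)

section \<open>The group and its normal filter\<close>

definition G :: "('v \<Rightarrow> 'v) set" where
  "G = range perm"

text \<open>This is the filter of finite supports: every block is finite, and finitely many atoms
  lie in an initial segment of the blocks.\<close>

definition \<F> :: "('v \<Rightarrow> 'v) set set" where
  "\<F> = {H. subgroup H B \<and> H \<subseteq> G \<and> (\<exists>m. perm ` fix_blocks m \<subseteq> H)}"

lemma filterI: "subgroup H B \<Longrightarrow> H \<subseteq> G \<Longrightarrow> perm ` fix_blocks m \<subseteq> H \<Longrightarrow> H \<in> \<F>"
  unfolding \<F>_def by (intro CollectI conjI exI)

lemma filterE: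
  assumes "H \<in> \<F>"
  obtains m where "subgroup H B" "H \<subseteq> G" "perm ` fix_blocks m \<subseteq> H"
  using assms unfolding \<F>_def by (elim CollectE conjE exE)

text \<open>Inverses come for free, each \<open>perm s\<close> being its own inverse.\<close>

lemma subgroup_permI:
  assumes "H \<subseteq> G" "perm (\<lambda>_. (False, False)) \<in> H"
    "\<And>s t. perm s \<in> H \<Longrightarrow> perm t \<in> H \<Longrightarrow> perm (add_shifts s t) \<in> H"
  shows "subgroup H B"
proof
  show "H \<subseteq> carrier B"
    using assms(1) perm_carrier by (auto simp: G_def)
  show "x \<otimes>\<^bsub>B\<^esub> y \<in> H" if xy: "x \<in> H" "y \<in> H" for x y
  proof -
    obtain s t where "x = perm s" "y = perm t"
      using xy assms(1) unfolding G_def by blast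
    then show ?thesis using xy assms(3) by (simp add: perm_mult)
  qed
  show "\<one>\<^bsub>B\<^esub> \<in> H"
    using assms(2) by (simp add: perm_zero)
  show "inv\<^bsub>B\<^esub> x \<in> H" if "x \<in> H" for x
    using that assms(1) by (force simp: G_def perm_inv)
qed

text \<open>The group is abelian, so conjugation is trivial on it and normality of the filter
  becomes immediate.\<close>

lemma conj_perm: "H \<subseteq> G \<Longrightarrow> \<pi> \<in> G \<Longrightarrow> (\<lambda>h. \<pi> \<otimes>\<^bsub>B\<^esub> h \<otimes>\<^bsub>B\<^esub> inv\<^bsub>B\<^esub> \<pi>) ` H = H"
proof -
  assume H: "H \<subseteq> G" "\<pi> \<in> G"
  then obtain s where s: "\<pi> = perm s" by (auto simp: G_def)
  have "\<pi> \<otimes>\<^bsub>B\<^esub> h \<otimes>\<^bsub>B\<^esub> inv\<^bsub>B\<^esub> \<pi> = h" if h: "h \<in> H" for h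
  proof -
    obtain t where t: "h = perm t" using h H(1) unfolding G_def by blast
    have "add_shifts (add_shifts s t) s = t"
      by (auto simp: add_shifts_def fun_eq_iff prod_eq_iff)
    then show ?thesis by (simp add: s t perm_inv perm_mult)
  qed
  then show ?thesis by force
qed

lemma normal_filter_stabilizers: "normal_filter G \<F>"
  unfolding normal_filter_def
proof (intro conjI)
  show sub: "subgroup G B"
    by (rule subgroup_permI) (auto simp: G_def)
  then show "G \<in> \<F>"
    by (auto simp: \<F>_def G_def)
  show "\<forall>H\<in>\<F>. subgroup H B \<and> H \<subseteq> G"
    by (simp add: \<F>_def)
  show "\<forall>H\<in>\<F>. \<forall>K. subgroup K B \<and> H \<subseteq> K \<and> K \<subseteq> G \<longrightarrow> K \<in> \<F>"
    by (auto elim!: filterE intro: filterI dest: subset_trans)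
  show "\<forall>H\<in>\<F>. \<forall>K\<in>\<F>. H \<inter> K \<in> \<F>"
  proof (intro ballI)
    fix H K assume HK: "H \<in> \<F>" "K \<in> \<F>"
    then obtain m n where H: "subgroup H B" "H \<subseteq> G" and K: "subgroup K B"
      and m: "perm ` fix_blocks m \<subseteq> H" and n: "perm ` fix_blocks n \<subseteq> K"
      by (elim filterE)
    have "perm ` fix_blocks (max m n) \<subseteq> H \<inter> K"
      using m n fix_blocks_mono[of _ "max m n"] by (auto simp: image_subset_iff)
    moreover have "subgroup (H \<inter> K) B"
      using H K by (intro group.subgroups_Inter_pair group_BijGroup)
    ultimately show "H \<inter> K \<in> \<F>"
      using H by (intro filterI) auto
  qed
  show "\<forall>H\<in>\<F>. \<forall>\<pi>\<in>G. (\<lambda>h. \<pi> \<otimes>\<^bsub>B\<^esub> h \<otimes>\<^bsub>B\<^esub> inv\<^bsub>B\<^esub> \<pi>) ` H \<in> \<F>"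
  proof (intro ballI)
    fix H \<pi> assume "H \<in> \<F>" "\<pi> \<in> G"
    moreover from this have "H \<subseteq> G" by (simp add: \<F>_def)
    ultimately show "(\<lambda>h. \<pi> \<otimes>\<^bsub>B\<^esub> h \<otimes>\<^bsub>B\<^esub> inv\<^bsub>B\<^esub> \<pi>) ` H \<in> \<F>"
      by (simp add: conj_perm)
  qed
  show "\<forall>a\<in>Atoms S. {\<pi> \<in> G. \<pi> a = a} \<in> \<F>"
  proof
    fix a assume "a \<in> Atoms S"
    then obtain i where i: "a = at i" by (rule atomE)
    have "subgroup {\<pi> \<in> G. \<pi> a = a} B"
      by (rule subgroup_permI) (auto simp: G_def i perm_at shift_zero shift_add, metis perm_at)
    moreover have "perm ` fix_blocks (Suc (fst i)) \<subseteq> {\<pi> \<in> G. \<pi> a = a}"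
      by (cases i) (auto simp: G_def i perm_at shift_def fix_blocks_def)
    ultimately show "{\<pi> \<in> G. \<pi> a = a} \<in> \<F>"
      by (intro filterI) auto
  qed
qed

lemma symmetric_iff:
  assumes "x \<in> Univ S"
  shows "symmetric G \<F> x \<longleftrightarrow> (\<exists>m. \<forall>s\<in>fix_blocks m. T s x = x)"
proof -
  have "subgroup {\<pi> \<in> G. act \<pi> x = x} B"
    using assms
    by (intro subgroup_permI) (auto simp: G_def T_def[symmetric] T_zero T_add)
  then have "symmetric G \<F> x \<longleftrightarrow> (\<exists>m. perm ` fix_blocks m \<subseteq> {\<pi> \<in> G. act \<pi> x = x})"
    by (auto simp: symmetric_def \<F>_def)
  also have "\<dots> \<longleftrightarrow> (\<exists>m. \<forall>s\<in>fix_blocks m. T s x = x)"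
    by (auto simp: image_subset_iff G_def T_def)
  finally show ?thesis .
qed

section \<open>Hereditarily symmetric sets\<close>

definition HS :: "'v set" where
  "HS = hereditarily_symmetric G \<F>"

lemma HS_subset_Univ: "HS \<subseteq> Univ S"
  by (auto simp: HS_def hereditarily_symmetric_def)

lemma HS_elts: "x \<in> HS \<Longrightarrow> elts x \<subseteq> HS"
proof
  fix y assume x: "x \<in> HS" and y: "y \<in> elts x"
  then have yx: "(y, x) \<in> mem_rel"
    using HS_subset_Univ by (auto simp: mem_rel_def)
  have "symmetric G \<F> z" if "(z, y) \<in> mem_rel\<^sup>*" for z
    using x rtrancl_into_rtrancl[OF that yx] by (simp add: HS_def hereditarily_symmetric_def)
  then show "y \<in> HS"
    using y elts_subset_Univ by (auto simp: HS_def hereditarily_symmetric_def)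
qed

lemma HS_I:
  assumes "x \<in> Univ S" "elts x \<subseteq> HS" "\<And>s. s \<in> fix_blocks m \<Longrightarrow> T s x = x"
  shows "x \<in> HS"
proof -
  have "symmetric G \<F> z" if "(z, x) \<in> mem_rel\<^sup>*" for z
    using that
  proof (cases rule: rtranclE)
    case base
    then show ?thesis using assms by (auto simp: symmetric_iff)
  next
    case (step y)
    then show ?thesis
      using assms(2) by (auto simp: mem_rel_def HS_def hereditarily_symmetric_def)
  qed
  then show ?thesis
    using assms(1) by (simp add: HS_def hereditarily_symmetric_def)
qed

lemma HS_support: "x \<in> HS \<Longrightarrow> \<exists>m. \<forall>s\<in>fix_blocks m. T s x = x"
  using symmetric_iff by (auto simp: HS_def hereditarily_symmetric_def)

lemma HS_Atoms: "Atoms S \<subseteq> HS"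
proof
  fix a assume a: "a \<in> Atoms S"
  then obtain i where i: "a = at i" by (rule atomE)
  show "a \<in> HS"
  proof (rule HS_I)
    show "a \<in> Univ S" using a Atoms_subset by blast
    show "elts a \<subseteq> HS" using elts_atom[OF a] by simp
    show "T s a = a" if "s \<in> fix_blocks (Suc (fst i))" for s
      using that by (cases i) (auto simp: i T_at shift_def fix_blocks_def)
  qed
qed

text \<open>Shifts commute, so whatever supports \<open>x\<close> also supports its image under
  \<open>T s\<close>; the elements are handled by induction.\<close>

lemma HS_T: "x \<in> HS \<Longrightarrow> T s x \<in> HS"
proof -
  assume "x \<in> HS"
  moreover from this have "x \<in> Univ S" using HS_subset_Univ by blast
  then have "x \<in> HS \<longrightarrow> T s x \<in> HS"
  proof (induction x rule: Univ_induct)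
    case (atom i)
    then show ?case
      using HS_Atoms at_Atoms by (metis T_at subsetD)
  next
    case (set x)
    show ?case
    proof
      assume x: "x \<in> HS"
      then obtain m where m: "\<forall>s\<in>fix_blocks m. T s x = x"
        using HS_support by blast
      show "T s x \<in> HS"
      proof (rule HS_I)
        show "T s x \<in> Univ S"
          using x HS_subset_Univ T_Univ by blast
        show "elts (T s x) \<subseteq> HS"
          using set HS_elts[OF x] by (auto simp: elts_T_set)
        show "T t (T s x) = T s x" if "t \<in> fix_blocks m" for t
          using m that T_commute x HS_subset_Univ by (metis subsetD)
      qed
    qed
  qed
  ultimately show ?thesis by blast
qed

text \<open>Mapping \<open>X\<close> into itself is enough for invariance: \<open>T s\<close> is an
  involution, so the inclusion of the image in \<open>X\<close> is already an equality.\<close>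

lemma HS_sets_ex:
  assumes "small X" "X \<subseteq> HS" "\<And>s x. s \<in> fix_blocks m \<Longrightarrow> x \<in> X \<Longrightarrow> T s x \<in> X"
  shows "\<exists>x\<in>sets \<inter> HS. elts x = X"
proof -
  obtain x where x: "x \<in> sets" "elts x = X"
    using assms(1) by (auto simp: small_def)
  have xU: "x \<in> Univ S" using x sets_subset_Univ by blast
  have "x \<in> HS"
  proof (rule HS_I)
    show "elts x \<subseteq> HS" using x assms by simp
    fix s assume s: "s \<in> fix_blocks m"
    have "T s ` X = X"
    proof
      show "T s ` X \<subseteq> X" using assms(3) s by auto
      show "X \<subseteq> T s ` X"
      proof
        fix x assume x: "x \<in> X"
        then have "T s (T s x) = x"
          using assms(2) HS_subset_Univ T_T by blast
        with assms(3)[OF s x] show "x \<in> T s ` X" by (metis imageI)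
      qed
    qed
    then show "T s x = x"
      using x by (intro extensionality T_sets) (simp_all add: elts_T_set)
  qed (rule xU)
  then show ?thesis using x by blast
qed

end

section \<open>The permutation model\<close>

text \<open>An assignment has infinitely many values, which may lack a common support. A formula
  depends on finitely many of them only, and finitely many values do have one. Any finite set that
  determines truth serves, so bound variables are included as well.\<close>

primrec fm_vars :: "fm \<Rightarrow> nat set" where
  "fm_vars (FMem i j) = {i, j}"
| "fm_vars (FEq i j) = {i, j}"
| "fm_vars (FAtom i) = {i}"
| "fm_vars (FNeg \<phi>) = fm_vars \<phi>"
| "fm_vars (FConj \<phi> \<psi>) = fm_vars \<phi> \<union> fm_vars \<psi>"
| "fm_vars (FAll i \<phi>) = insert i (fm_vars \<phi>)"

lemma finite_fm_vars: "finite (fm_vars \<phi>)"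
  by (induction \<phi>) auto

lemma (in in_structure) sat_cong:
  "(\<And>i. i \<in> fm_vars \<phi> \<Longrightarrow> e i = e' i) \<Longrightarrow> sat \<phi> e \<longleftrightarrow> sat \<phi> e'"
proof (induction \<phi> arbitrary: e e')
  case (FConj \<phi> \<psi>)
  have "sat \<phi> e \<longleftrightarrow> sat \<phi> e'" "sat \<psi> e \<longleftrightarrow> sat \<psi> e'"
    by (rule FConj.IH, simp add: FConj.prems)+
  then show ?case by simp
next
  case (FAll i \<phi>)
  have "sat \<phi> (e(i := x)) \<longleftrightarrow> sat \<phi> (e'(i := x))" for x
    by (rule FAll.IH) (simp add: FAll.prems)
  then show ?case by simp
next
  case (FNeg \<phi>)
  have "sat \<phi> e \<longleftrightarrow> sat \<phi> e'"
    by (rule FNeg.IH) (simp add: FNeg.prems)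
  then show ?case by simp
qed simp_all

lemma zero_in_fix_blocks: "(\<lambda>_. (False, False)) \<in> fix_blocks m"
  by (simp add: fix_blocks_def)

lemma add_in_fix_blocks: "s \<in> fix_blocks m \<Longrightarrow> t \<in> fix_blocks m \<Longrightarrow> add_shifts s t \<in> fix_blocks m"
  by (simp add: fix_blocks_def add_shifts_def)

text \<open>Here \<open>N\<close> is the permutation model and \<open>small\<close> singles out those subsets of it that are
  sets of the ground universe.\<close>

locale klein_model = in_structure N for N :: "'v zfa_structure" +
  fixes small :: "'v set \<Rightarrow> bool"
    and T :: "(nat \<Rightarrow> bool \<times> bool) \<Rightarrow> 'v \<Rightarrow> 'v"
    and at :: "nat \<times> bool \<times> bool \<Rightarrow> 'v"
  assumes extensionality: "x \<in> sets \<Longrightarrow> y \<in> sets \<Longrightarrow> elts x = elts y \<Longrightarrow> x = y"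
    and wf_mem_rel: "wf mem_rel"
    and Atoms_subset: "Atoms N \<subseteq> Univ N"
    and elts_atom: "a \<in> Atoms N \<Longrightarrow> elts a = {}"
    and bij_at: "bij_betw at UNIV (Atoms N)"
    and T_at: "T s (at i) = at (shift s i)"
    and T_Univ: "x \<in> Univ N \<Longrightarrow> T s x \<in> Univ N"
    and T_sets: "x \<in> sets \<Longrightarrow> T s x \<in> sets"
    and elts_T: "x \<in> Univ N \<Longrightarrow> elts (T s x) = T s ` elts x"
    and T_add: "x \<in> Univ N \<Longrightarrow> T (add_shifts s t) x = T s (T t x)"
    and T_zero: "x \<in> Univ N \<Longrightarrow> T (\<lambda>_. (False, False)) x = x"
    and support: "x \<in> Univ N \<Longrightarrow> \<exists>m. \<forall>s\<in>fix_blocks m. T s x = x"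
    and sets_ex: "small X \<Longrightarrow> X \<subseteq> Univ N \<Longrightarrow>
      (\<And>s x. s \<in> fix_blocks m \<Longrightarrow> x \<in> X \<Longrightarrow> T s x \<in> X) \<Longrightarrow> \<exists>x\<in>sets. elts x = X"
    and small_elts: "x \<in> Univ N \<Longrightarrow> small (elts x)"
    and small_Atoms: "small (Atoms N)"
    and small_subset: "small X \<Longrightarrow> Y \<subseteq> X \<Longrightarrow> small Y"
    and small_image: "small X \<Longrightarrow> f ` X \<subseteq> Univ N \<Longrightarrow> small (f ` X)"
    and small_UN: "small I \<Longrightarrow> (\<And>i. i \<in> I \<Longrightarrow> small (F i)) \<Longrightarrow> small (\<Union>i\<in>I. F i)"
    and small_Pow: "small X \<Longrightarrow> small {y \<in> sets. elts y \<subseteq> X}"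
    and small_range: "range g \<subseteq> Univ N \<Longrightarrow> small (range (g :: nat \<Rightarrow> 'v))"
begin

lemma elts_subset_Univ: "elts x \<subseteq> Univ N"
  by (auto simp: elts_def)

lemma elts_Univ: "y \<in> elts x \<Longrightarrow> y \<in> Univ N"
  by (simp add: elts_def)

lemma sets_Univ: "x \<in> sets \<Longrightarrow> x \<in> Univ N"
  by (simp add: sets_def)

lemma setsI: "x \<in> Univ N \<Longrightarrow> elts x \<noteq> {} \<Longrightarrow> x \<in> sets"
  using elts_atom by (auto simp: sets_def)

lemma T_T: "x \<in> Univ N \<Longrightarrow> T s (T s x) = x"
  by (simp add: T_add[symmetric] add_shifts_self T_zero)

lemma T_inj: "x \<in> Univ N \<Longrightarrow> y \<in> Univ N \<Longrightarrow> T s x = T s y \<longleftrightarrow> x = y"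
  by (metis T_T)

lemma T_mem: "x \<in> Univ N \<Longrightarrow> y \<in> Univ N \<Longrightarrow> T s y \<in> elts (T s x) \<longleftrightarrow> y \<in> elts x"
  using inj_on_image_mem_iff[of "T s" "Univ N" y "elts x"] elts_subset_Univ T_inj
  by (simp add: elts_T inj_on_def)

lemma T_elts: "x \<in> Univ N \<Longrightarrow> T s x = x \<Longrightarrow> y \<in> elts x \<Longrightarrow> T s y \<in> elts x"
  using T_mem elts_Univ by metis

lemma T_Atoms: "x \<in> Univ N \<Longrightarrow> T s x \<in> Atoms N \<longleftrightarrow> x \<in> Atoms N"
proof -
  assume x: "x \<in> Univ N"
  have "T s y \<in> Atoms N" if "y \<in> Atoms N" for y
    using that bij_at T_at unfolding bij_betw_def by (metis rangeE rangeI)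
  then show ?thesis by (metis T_T x)
qed

lemma T_set_eqI: "x \<in> sets \<Longrightarrow> y \<in> sets \<Longrightarrow> T s ` elts x = elts y \<Longrightarrow> T s x = y"
  using extensionality[OF T_sets] elts_T sets_Univ by metis

lemma at_Atoms: "at i \<in> Atoms N"
  using bij_at by (auto simp: bij_betw_def)

lemma at_Univ: "at i \<in> Univ N"
  using at_Atoms Atoms_subset by blast

lemma inj_at: "inj at"
  using bij_at by (simp add: bij_betw_def)

text \<open>\<open>T s\<close> is an automorphism of the model. In the quantifier case the bound
  value is reindexed by \<open>T s\<close>, which permutes the universe.\<close>

lemma sat_T:
  "range e \<subseteq> Univ N \<Longrightarrow> sat \<phi> (\<lambda>i. T s (e i)) \<longleftrightarrow> sat \<phi> e"
proof (induction \<phi> arbitrary: e)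
  case (FMem i j)
  then have "e i \<in> Univ N" "e j \<in> Univ N" by auto
  moreover have "Mem N x y \<longleftrightarrow> x \<in> elts y" if "x \<in> Univ N" for x y
    using that by (simp add: elts_def)
  ultimately show ?case by (simp add: T_mem T_Univ)
next
  case (FEq i j)
  then show ?case by (simp add: T_inj image_subset_iff)
next
  case (FAtom i)
  then show ?case by (simp add: T_Atoms image_subset_iff)
next
  case (FAll i \<phi>)
  have *: "sat \<phi> ((\<lambda>j. T s (e j))(i := T s x)) \<longleftrightarrow> sat \<phi> (e(i := x))" if "x \<in> Univ N" for x
  proof -
    have eq: "(\<lambda>j. T s (e j))(i := T s x) = (\<lambda>j. T s ((e(i := x)) j))"
      by auto
    have "range (e(i := x)) \<subseteq> Univ N"
      using FAll.prems that by (auto simp: image_subset_iff)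
    then show ?thesis
      unfolding eq by (rule FAll.IH)
  qed
  have "(\<forall>x\<in>Univ N. sat \<phi> ((\<lambda>j. T s (e j))(i := x))) \<longleftrightarrow>
    (\<forall>x\<in>Univ N. sat \<phi> ((\<lambda>j. T s (e j))(i := T s x)))"
    by (metis T_T T_Univ)
  then show ?case by (simp add: *)
qed auto

lemma finite_support:
  assumes "finite A" "A \<subseteq> Univ N"
  shows "\<exists>m. \<forall>s\<in>fix_blocks m. \<forall>x\<in>A. T s x = x"
  using assms
proof (induction A rule: finite_induct)
  case (insert a A)
  then obtain m where m: "\<forall>s\<in>fix_blocks m. \<forall>x\<in>A. T s x = x" by auto
  obtain n where n: "\<forall>s\<in>fix_blocks n. T s a = a"
    using support[of a] insert.prems by auto
  have "\<forall>s\<in>fix_blocks (max m n). \<forall>x\<in>insert a A. T s x = x"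
    using m n fix_blocks_mono by (metis insert_iff max.cobounded1 max.cobounded2)
  then show ?case ..
qed simp

text \<open>How definable sets enter the model: a class defined from finitely many parameters is
  invariant under every shift that fixes the parameters, and these have a common support.\<close>

lemma ex_set_finite_support:
  assumes "small X" "X \<subseteq> Univ N" "finite A" "A \<subseteq> Univ N"
    and "\<And>s x. (\<And>a. a \<in> A \<Longrightarrow> T s a = a) \<Longrightarrow> x \<in> X \<Longrightarrow> T s x \<in> X"
  shows "\<exists>x\<in>sets. elts x = X"
proof -
  obtain m where m: "\<And>s x. s \<in> fix_blocks m \<Longrightarrow> x \<in> A \<Longrightarrow> T s x = x"
    using finite_support[OF assms(3,4)] by blast
  show ?thesis
    by (rule sets_ex[OF assms(1,2)], rule assms(5), rule m)
qed

lemma small_pair: "x \<in> Univ N \<Longrightarrow> y \<in> Univ N \<Longrightarrow> small {x, y}"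
proof -
  assume "x \<in> Univ N" "y \<in> Univ N"
  moreover have "range (\<lambda>n::nat. if n = 0 then x else y) = {x, y}"
    by (auto intro: range_eqI[of _ _ 0] range_eqI[of _ _ 1])
  ultimately show ?thesis
    using small_range[of "\<lambda>n. if n = 0 then x else y"] by auto
qed

lemma small_empty: "small {}"
  using small_subset[OF small_Atoms] by blast

lemma small_Un: "small X \<Longrightarrow> small Y \<Longrightarrow> small (X \<union> Y)"
proof -
  assume XY: "small X" "small Y"
  \<comment> \<open>Two distinct atoms serve as the index set that reduces a binary union to an
    indexed one.\<close>
  have "(\<Union>i\<in>{at (0, True, True), at (1, True, True)}. if i = at (0, True, True) then X else Y) = X \<union> Y"
    using inj_at by (auto simp: inj_eq)
  moreover have "small (\<Union>i\<in>{at (0, True, True), at (1, True, True)}. if i = at (0, True, True) then X else Y)"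
    using XY by (intro small_UN small_pair at_Univ) auto
  ultimately show ?thesis by simp
qed

lemma small_insert: "x \<in> Univ N \<Longrightarrow> small X \<Longrightarrow> small (insert x X)"
  using small_Un[OF small_pair, of x x X] by simp

lemma small_finite: "finite X \<Longrightarrow> X \<subseteq> Univ N \<Longrightarrow> small X"
  by (induction X rule: finite_induct) (auto simp: small_empty small_insert)

lemma finite_set_ex: "finite X \<Longrightarrow> X \<subseteq> Univ N \<Longrightarrow> \<exists>x\<in>sets. elts x = X"
  by (rule ex_set_finite_support[where A = X]) (auto simp: small_finite)

definition set_of :: "'v set \<Rightarrow> 'v" where
  "set_of X = (THE x. x \<in> sets \<and> elts x = X)"

lemma set_of:
  assumes "\<exists>x\<in>sets. elts x = X"
  shows "set_of X \<in> sets" "elts (set_of X) = X"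
proof -
  have "\<exists>!x. x \<in> sets \<and> elts x = X"
    using assms extensionality by auto
  from theI'[OF this] show "set_of X \<in> sets" "elts (set_of X) = X"
    by (auto simp: set_of_def)
qed

text \<open>That the image is small comes from the ground universe. A support comes from
  \<open>x\<close> and the finitely many parameters of the formula, because truth is invariant under
  shifts.\<close>

lemma replacement: replacement_schema
  unfolding replacement_schema_def
proof (intro allI ballI impI, elim conjE)
  fix \<phi> e x
  assume x: "x \<in> Univ N" and e: "range e \<subseteq> Univ N"
    and fn: "\<forall>u\<in>elts x. \<forall>v\<in>Univ N. \<forall>w\<in>Univ N.
      sat \<phi> (e(0 := u, 1 := v)) \<and> sat \<phi> (e(0 := u, 1 := w)) \<longrightarrow> v = w"
  define X where "X = {v \<in> Univ N. \<exists>u\<in>elts x. sat \<phi> (e(0 := u, 1 := v))}"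
  define D where "D = {u \<in> elts x. \<exists>v\<in>Univ N. sat \<phi> (e(0 := u, 1 := v))}"
  define h where "h u = (SOME v. v \<in> Univ N \<and> sat \<phi> (e(0 := u, 1 := v)))" for u
  have h: "h u \<in> Univ N \<and> sat \<phi> (e(0 := u, 1 := h u))" if "u \<in> D" for u
    unfolding h_def by (rule someI_ex) (use that in \<open>auto simp: D_def\<close>)
  have "small D"
    using small_subset[OF small_elts[OF x]] by (simp add: D_def)
  then have "small (h ` D)"
    using h by (intro small_image) auto
  moreover have "X \<subseteq> h ` D"
  proof
    fix v assume "v \<in> X"
    then obtain u where u: "v \<in> Univ N" "u \<in> elts x" "sat \<phi> (e(0 := u, 1 := v))"
      unfolding X_def by blast
    then have "u \<in> D" by (auto simp: D_def)
    with h[OF this] fn u have "v = h u" by blast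
    with \<open>u \<in> D\<close> show "v \<in> h ` D" by blast
  qed
  ultimately have "small X" by (rule small_subset)
  have "\<exists>y\<in>sets. elts y = X"
  proof (rule ex_set_finite_support[where A = "insert x (e ` fm_vars \<phi>)"])
    show "finite (insert x (e ` fm_vars \<phi>))" by (simp add: finite_fm_vars)
    show "insert x (e ` fm_vars \<phi>) \<subseteq> Univ N" using x e by auto
    fix s v assume s: "\<And>a. a \<in> insert x (e ` fm_vars \<phi>) \<Longrightarrow> T s a = a" and v: "v \<in> X"
    then obtain u where u: "v \<in> Univ N" "u \<in> elts x" "sat \<phi> (e(0 := u, 1 := v))"
      unfolding X_def by blast
    have "range (e(0 := u, 1 := v)) \<subseteq> Univ N"
      using e u elts_Univ by (auto simp: image_subset_iff)
    from sat_T[OF this, of \<phi> s] u(3)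
    have "sat \<phi> (\<lambda>i. T s ((e(0 := u, 1 := v)) i))" by simp
    also have "sat \<phi> (\<lambda>i. T s ((e(0 := u, 1 := v)) i)) \<longleftrightarrow> sat \<phi> (e(0 := T s u, 1 := T s v))"
      by (rule sat_cong) (use s in auto)
    finally show "T s v \<in> X"
      using T_Univ[OF u(1)] T_elts[OF x _ u(2)] s unfolding X_def by blast
  qed (use \<open>small X\<close> in \<open>auto simp: X_def\<close>)
  then show "\<exists>y\<in>sets. elts y = {v \<in> Univ N. \<exists>u\<in>elts x. sat \<phi> (e(0 := u, 1 := v))}"
    by (simp add: X_def)
qed

section \<open>Natural numbers of the model\<close>

primrec num :: "nat \<Rightarrow> 'v" where
  "num 0 = set_of {}"
| "num (Suc n) = set_of (insert (num n) (elts (num n)))"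

lemma num: "num n \<in> sets \<and> elts (num n) = num ` {..<n}"
proof (induction n)
  case 0
  then show ?case using set_of[OF finite_set_ex[of "{}"]] by simp
next
  case (Suc n)
  then have "finite (insert (num n) (elts (num n)))" by simp
  moreover have "insert (num n) (elts (num n)) \<subseteq> Univ N"
    using Suc sets_Univ elts_subset_Univ[of "num n"] by simp
  ultimately have "\<exists>x\<in>sets. elts x = insert (num n) (elts (num n))"
    by (rule finite_set_ex)
  from set_of[OF this] show ?case
    using Suc by (simp add: lessThan_Suc)
qed

declare num.simps [simp del]

lemma num_sets: "num n \<in> sets" and elts_num: "elts (num n) = num ` {..<n}"
  using num by auto

lemma num_Univ: "num n \<in> Univ N"
  using num_sets sets_Univ by blast

lemma inj_num: "inj num"
proof -
  have "num m \<noteq> num n" if "m < n" for m n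
  proof
    assume "num m = num n"
    with that have "num n \<in> elts (num n)" by (metis elts_num imageI lessThan_iff)
    then have "(num n, num n) \<in> mem_rel" by (simp add: mem_rel_def num_Univ)
    with wf_mem_rel show False by simp
  qed
  then show ?thesis by (metis injI nat_neq_iff)
qed

text \<open>Numerals contain no atoms in their transitive closure, so nothing moves them.
  Consequently a map into the numerals is equivariant as soon as it is constant on orbits.\<close>

lemma T_num: "T s (num n) = num n"
proof (induction n rule: less_induct)
  case (less n)
  then have "T s ` elts (num n) = elts (num n)"
    by (auto simp: elts_num image_iff)
  then show ?case by (intro T_set_eqI num_sets)
qed

lemma is_empty_num: "is_empty x \<longleftrightarrow> x = num 0"
  unfolding is_empty_def using extensionality num_sets[of 0] elts_num[of 0] by auto

lemma is_succ_num: "is_succ x (num n) \<longleftrightarrow> x = num (Suc n)"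
  unfolding is_succ_def using extensionality num_sets[of "Suc n"] elts_num[of "Suc n"] elts_num[of n]
  by (auto simp: lessThan_Suc)

lemma ex_omega: "\<exists>I\<in>sets. elts I = range num"
  by (rule sets_ex[of _ 0]) (auto simp: T_num num_Univ intro!: small_range)

lemma inductive_omega: "I \<in> sets \<Longrightarrow> elts I = range num \<Longrightarrow> inductive_in I"
  unfolding inductive_in_def by (auto simp: is_empty_num is_succ_num)

text \<open>The standard numerals form an inductive set of the model, so the model has no
  nonstandard naturals. This is what makes internal finiteness agree with
  \<open>finite\<close>.\<close>

lemma natural_iff: "natural n \<longleftrightarrow> (\<exists>k. n = num k)"
proof
  assume "natural n"
  then show "\<exists>k. n = num k"
    using ex_omega inductive_omega sets_Univ unfolding natural_def by blast
next
  have "num k \<in> elts I" if "inductive_in I" for k I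
  proof (induction k)
    case 0
    then show ?case using that by (auto simp: inductive_in_def is_empty_num)
  next
    case (Suc k)
    with that obtain y where "y \<in> elts I" "is_succ y (num k)"
      unfolding inductive_in_def by blast
    then show ?case by (simp add: is_succ_num)
  qed
  moreover assume "\<exists>k. n = num k"
  ultimately show "natural n" by (auto simp: natural_def num_Univ)
qed

lemma ZFA: ZFA
proof -
  have "\<forall>a\<in>Atoms N. elts a = {}"
    using elts_atom by blast
  moreover have "\<exists>A\<in>sets. elts A = Atoms N"
    by (rule sets_ex[of _ 0]) (use Atoms_subset T_Atoms small_Atoms in auto)
  moreover have "\<forall>x\<in>sets. \<forall>y\<in>sets. elts x = elts y \<longrightarrow> x = y"
    using extensionality by blast
  moreover have "\<forall>x\<in>Univ N. elts x \<noteq> {} \<longrightarrow> (\<exists>y\<in>elts x. elts y \<inter> elts x = {})"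
  proof (intro ballI impI)
    fix x assume "elts x \<noteq> {}"
    then obtain y where y: "y \<in> elts x" "\<And>z. (z, y) \<in> mem_rel \<Longrightarrow> z \<notin> elts x"
      using wfE_min[OF wf_mem_rel] by (metis ex_in_conv)
    then have "elts y \<inter> elts x = {}"
      using elts_Univ by (auto simp: mem_rel_def)
    with y show "\<exists>y\<in>elts x. elts y \<inter> elts x = {}" by blast
  qed
  moreover have "\<forall>x\<in>Univ N. \<forall>y\<in>Univ N. \<exists>z\<in>sets. elts z = {x, y}"
    by (intro ballI finite_set_ex) auto
  moreover have "\<forall>x\<in>Univ N. \<exists>u\<in>sets. elts u = (\<Union>y\<in>elts x. elts y)"
  proof
    fix x assume x: "x \<in> Univ N"
    show "\<exists>u\<in>sets. elts u = (\<Union>y\<in>elts x. elts y)"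
    proof (rule ex_set_finite_support[where A = "{x}"])
      show "small (\<Union>y\<in>elts x. elts y)"
        by (intro small_UN small_elts x) (rule elts_Univ)
      show "(\<Union>y\<in>elts x. elts y) \<subseteq> Univ N" using elts_Univ by blast
      fix s z assume s: "\<And>a. a \<in> {x} \<Longrightarrow> T s a = a" and "z \<in> (\<Union>y\<in>elts x. elts y)"
      then obtain y where "y \<in> elts x" "z \<in> elts y" by blast
      then have "T s y \<in> elts x" "T s z \<in> elts (T s y)"
        using s x T_elts T_mem elts_Univ by auto
      then show "T s z \<in> (\<Union>y\<in>elts x. elts y)" by blast
    qed (use x in auto)
  qed
  moreover have "\<forall>x\<in>sets. \<exists>p\<in>sets. elts p = {y \<in> sets. elts y \<subseteq> elts x}"
  proof
    fix x assume "x \<in> sets"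
    then have x: "x \<in> Univ N" by (rule sets_Univ)
    show "\<exists>p\<in>sets. elts p = {y \<in> sets. elts y \<subseteq> elts x}"
    proof (rule ex_set_finite_support[where A = "{x}"])
      show "small {y \<in> sets. elts y \<subseteq> elts x}"
        by (intro small_Pow small_elts x)
      show "{y \<in> sets. elts y \<subseteq> elts x} \<subseteq> Univ N" using sets_Univ by blast
      fix s y assume "\<And>a. a \<in> {x} \<Longrightarrow> T s a = a" "y \<in> {y \<in> sets. elts y \<subseteq> elts x}"
      then show "T s y \<in> {y \<in> sets. elts y \<subseteq> elts x}"
        using x T_elts T_sets elts_T sets_Univ by auto
    qed (use x in auto)
  qed
  moreover have "\<exists>I\<in>Univ N. inductive_in I"
    using ex_omega inductive_omega sets_Univ by blast
  moreover note Atoms_subset replacement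
  ultimately show ?thesis
    unfolding ZFA_def by - (intro conjI; assumption)
qed

end

context klein_model
begin

section \<open>Pairs, relations and functions of the model\<close>

definition pr :: "'v \<Rightarrow> 'v \<Rightarrow> 'v" where
  "pr x y = (THE p. is_pair p x y)"

lemma is_pair_Univ: "is_pair p x y \<Longrightarrow> p \<in> Univ N \<and> x \<in> Univ N \<and> y \<in> Univ N"
  unfolding is_pair_def using elts_Univ by (metis insertI1 insert_commute)

lemma is_pair_elts: "is_pair p x y \<Longrightarrow> elts ` elts p = {{x}, {x, y}}"
  unfolding is_pair_def by auto

lemma is_pair_inj: "is_pair p x y \<Longrightarrow> is_pair p x' y' \<Longrightarrow> x = x' \<and> y = y'"
  using is_pair_elts[of p x y] is_pair_elts[of p x' y'] by (auto simp: doubleton_eq_iff)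

lemma is_pair_unique:
  assumes "is_pair p x y" "is_pair q x y"
  shows "p = q"
proof -
  obtain u v where p: "p \<in> Univ N" "u \<in> Univ N" "v \<in> Univ N"
    "elts u = {x}" "elts v = {x, y}" "elts p = {u, v}"
    using assms(1) unfolding is_pair_def by blast
  obtain u' v' where q: "q \<in> Univ N" "u' \<in> Univ N" "v' \<in> Univ N"
    "elts u' = {x}" "elts v' = {x, y}" "elts q = {u', v'}"
    using assms(2) unfolding is_pair_def by blast
  have "u = u'" "v = v'"
    using p q by (auto intro!: extensionality setsI)
  then show ?thesis
    using p q by (intro extensionality setsI) auto
qed

lemma is_pair_pr: "x \<in> Univ N \<Longrightarrow> y \<in> Univ N \<Longrightarrow> is_pair (pr x y) x y"
proof -
  assume xy: "x \<in> Univ N" "y \<in> Univ N"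
  then obtain u v where uv: "u \<in> sets" "elts u = {x}" "v \<in> sets" "elts v = {x, y}"
    using finite_set_ex[of "{x}"] finite_set_ex[of "{x, y}"] by auto
  then obtain p where "p \<in> sets" "elts p = {u, v}"
    using finite_set_ex[of "{u, v}"] sets_Univ by auto
  then have "is_pair p x y"
    using uv sets_Univ unfolding is_pair_def by blast
  then show ?thesis
    unfolding pr_def by (rule theI) (rule is_pair_unique[OF _ \<open>is_pair p x y\<close>])
qed

lemma is_pair_iff: "is_pair p x y \<longleftrightarrow> x \<in> Univ N \<and> y \<in> Univ N \<and> p = pr x y"
  using is_pair_pr is_pair_Univ is_pair_unique by blast

lemma pr_Univ: "x \<in> Univ N \<Longrightarrow> y \<in> Univ N \<Longrightarrow> pr x y \<in> Univ N"
  using is_pair_Univ[OF is_pair_pr] by blast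

lemma pr_inject:
  "x \<in> Univ N \<Longrightarrow> y \<in> Univ N \<Longrightarrow> x' \<in> Univ N \<Longrightarrow> y' \<in> Univ N \<Longrightarrow> pr x y = pr x' y' \<longleftrightarrow> x = x' \<and> y = y'"
  by (metis is_pair_inj is_pair_pr)

lemma T_pr:
  assumes "x \<in> Univ N" "y \<in> Univ N"
  shows "T s (pr x y) = pr (T s x) (T s y)"
proof -
  obtain u v where uv: "u \<in> Univ N" "v \<in> Univ N" "elts u = {x}" "elts v = {x, y}"
    "elts (pr x y) = {u, v}"
    using is_pair_pr[OF assms] unfolding is_pair_def by blast
  then have "elts (T s u) = {T s x}" "elts (T s v) = {T s x, T s y}"
    "elts (T s (pr x y)) = {T s u, T s v}"
    using elts_T pr_Univ[OF assms] by auto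
  then have "is_pair (T s (pr x y)) (T s x) (T s y)"
    using T_Univ uv(1,2) pr_Univ[OF assms] unfolding is_pair_def by blast
  then show ?thesis by (simp add: is_pair_iff)
qed

lemma small_pairs:
  assumes "small X" "small Y" "X \<subseteq> Univ N" "Y \<subseteq> Univ N"
  shows "small ((\<lambda>(x, y). pr x y) ` (X \<times> Y))"
proof -
  have "(\<lambda>(x, y). pr x y) ` (X \<times> Y) = (\<Union>x\<in>X. pr x ` Y)" by auto
  moreover have "small (pr x ` Y)" if "x \<in> X" for x
    using assms that pr_Univ by (intro small_image) auto
  ultimately show ?thesis
    using small_UN[OF assms(1)] by simp
qed

lemma rel_iff: "(x, y) \<in> rel r \<longleftrightarrow> x \<in> Univ N \<and> y \<in> Univ N \<and> pr x y \<in> elts r"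
  unfolding rel_def by (auto simp: is_pair_iff)

lemma rel_T: "r \<in> Univ N \<Longrightarrow> T s r = r \<Longrightarrow> (x, y) \<in> rel r \<Longrightarrow> (T s x, T s y) \<in> rel r"
  unfolding rel_iff using T_pr T_elts T_Univ by metis

lemma is_relation_subset: "is_relation r X Y \<Longrightarrow> rel r \<subseteq> elts X \<times> elts Y"
  unfolding is_relation_def rel_def using is_pair_inj by fastforce

text \<open>Pairing commutes with \<open>T s\<close>, so an invariant HOL relation gives an
  invariant set of pairs, which the model contains.\<close>

lemma encode_rel:
  assumes XY: "X \<in> Univ N" "Y \<in> Univ N" and R: "R \<subseteq> elts X \<times> elts Y"
    and inv: "\<And>s x y. s \<in> fix_blocks m \<Longrightarrow> (x, y) \<in> R \<Longrightarrow> (T s x, T s y) \<in> R"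
  obtains r where "is_relation r X Y" "rel r = R"
proof -
  have RU: "x \<in> Univ N" "y \<in> Univ N" if "(x, y) \<in> R" for x y
    using that R elts_Univ by blast+
  have "small ((\<lambda>(x, y). pr x y) ` R)"
    by (rule small_subset[OF small_pairs[OF small_elts[OF XY(1)] small_elts[OF XY(2)]
      elts_subset_Univ elts_subset_Univ]]) (use R in auto)
  moreover have "(\<lambda>(x, y). pr x y) ` R \<subseteq> Univ N"
    using RU pr_Univ by auto
  moreover have "T s p \<in> (\<lambda>(x, y). pr x y) ` R"
    if s: "s \<in> fix_blocks m" and p: "p \<in> (\<lambda>(x, y). pr x y) ` R" for s p
  proof -
    obtain x y where xy: "(x, y) \<in> R" "p = pr x y" using p by auto
    then have "T s p = pr (T s x) (T s y)" using RU T_pr by simp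
    with inv[OF s xy(1)] show ?thesis by (auto intro: rev_image_eqI)
  qed
  ultimately obtain r where r: "r \<in> sets" "elts r = (\<lambda>(x, y). pr x y) ` R"
    using sets_ex by metis
  show ?thesis
  proof (rule that)
    show "is_relation r X Y"
      unfolding is_relation_def is_pair_iff using r R RU by fastforce
    have "(x, y) \<in> R" if "x \<in> Univ N" "y \<in> Univ N" "pr x y \<in> elts r" for x y
      using that unfolding r(2) by (auto simp: RU pr_inject)
    moreover have "pr x y \<in> elts r" if "(x, y) \<in> R" for x y
      using imageI[OF that, of "\<lambda>(x, y). pr x y"] unfolding r(2) by simp
    ultimately have "(x, y) \<in> rel r \<longleftrightarrow> (x, y) \<in> R" for x y
      unfolding rel_iff using RU by blast
    then show "rel r = R" by auto
  qed
qed

lemma is_functionD: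
  assumes "is_function f X Y" "x \<in> elts X"
  shows "(x, app f x) \<in> rel f" "app f x \<in> elts Y" "(x, y) \<in> rel f \<Longrightarrow> app f x = y"
proof -
  have ex1: "\<exists>!y. (x, y) \<in> rel f" and "is_relation f X Y"
    using assms unfolding is_function_def by blast+
  show *: "(x, app f x) \<in> rel f" unfolding app_def by (rule theI'[OF ex1])
  then show "app f x \<in> elts Y" using is_relation_subset \<open>is_relation f X Y\<close> by blast
  show "app f x = y" if "(x, y) \<in> rel f" using ex1 * that by blast
qed

lemma is_function_Univ: "is_function f X Y \<Longrightarrow> f \<in> Univ N"
  unfolding is_function_def is_relation_def using sets_Univ by blast

lemma app_T:
  assumes f: "is_function f X Y" "T s f = f" and X: "X \<in> Univ N" "T s X = X" and x: "x \<in> elts X"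
  shows "app f (T s x) = T s (app f x)"
  using is_functionD(1)[OF f(1) x] is_functionD(3)[OF f(1) T_elts[OF X x]]
    rel_T[OF is_function_Univ[OF f(1)] f(2)] by blast

lemma encode_fun:
  assumes XY: "X \<in> Univ N" "Y \<in> Univ N" and f: "\<And>x. x \<in> elts X \<Longrightarrow> f x \<in> elts Y"
    and inv: "\<And>s x. s \<in> fix_blocks m \<Longrightarrow> x \<in> elts X \<Longrightarrow> f (T s x) = T s (f x)"
  obtains c where "is_function c X Y" "\<And>x. x \<in> elts X \<Longrightarrow> app c x = f x"
proof -
  \<comment> \<open>The graph of \<open>f\<close> is invariant only under shifts that also map
    \<open>X\<close> to itself; hence a support of \<open>X\<close> joins the given
    \<open>m\<close>.\<close>
  obtain n where n: "\<And>s. s \<in> fix_blocks n \<Longrightarrow> T s X = X"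
    using support[OF XY(1)] by blast
  define R where "R = {(x, f x) |x. x \<in> elts X}"
  have "(T s x, T s y) \<in> R" if s: "s \<in> fix_blocks (max m n)" and xy: "(x, y) \<in> R" for s x y
  proof -
    have "s \<in> fix_blocks m" "s \<in> fix_blocks n" using s fix_blocks_mono by auto
    with xy show ?thesis
      using inv T_elts[OF XY(1) n] by (auto simp: R_def)
  qed
  moreover have "R \<subseteq> elts X \<times> elts Y" using f by (auto simp: R_def)
  ultimately obtain c where c: "is_relation c X Y" "rel c = R"
    using encode_rel[OF XY] by metis
  have "is_function c X Y"
    unfolding is_function_def using c by (auto simp: R_def)
  moreover have "app c x = f x" if "x \<in> elts X" for x
    using is_functionD(3)[OF \<open>is_function c X Y\<close> that] that c by (auto simp: R_def)
  ultimately show ?thesis using that by blast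
qed

text \<open>Internal finiteness implies finiteness because the naturals are standard. Conversely,
  finitely many elements have a common support, whose shifts fix them and all numerals, so every HOL
  bijection with a numeral is in the model.\<close>

lemma finite_in_iff:
  assumes X: "X \<in> Univ N"
  shows "finite_in X \<longleftrightarrow> finite (elts X)"
proof
  assume "finite_in X"
  then obtain k f where "bij_betw (app f) (elts X) (elts (num k))"
    unfolding finite_in_def natural_iff by blast
  then show "finite (elts X)"
    using bij_betw_finite by (fastforce simp: elts_num)
next
  assume fin: "finite (elts X)"
  then obtain b where b: "bij_betw b (elts X) {..<card (elts X)}"
    using ex_bij_betw_finite_nat[OF fin] by (auto simp: atLeast0LessThan)
  obtain m where m: "\<forall>s\<in>fix_blocks m. \<forall>x\<in>elts X. T s x = x"
    using finite_support[OF fin elts_subset_Univ] by blast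
  define n where "n = num (card (elts X))"
  have bn: "bij_betw (num \<circ> b) (elts X) (elts n)"
    unfolding n_def elts_num by (rule bij_betw_trans[OF b]) (simp add: bij_betw_def inj_on_subset[OF inj_num])
  obtain c where c: "is_function c X n" "\<And>x. x \<in> elts X \<Longrightarrow> app c x = (num \<circ> b) x"
  proof (rule encode_fun[OF X])
    show "n \<in> Univ N" by (simp add: n_def num_Univ)
    show "(num \<circ> b) x \<in> elts n" if "x \<in> elts X" for x
      using bn that by (rule bij_betw_apply)
    show "(num \<circ> b) (T s x) = T s ((num \<circ> b) x)" if "s \<in> fix_blocks m" "x \<in> elts X" for s x
      using m that by (simp add: T_num)
  qed blast
  have "bij_betw (app c) (elts X) (elts n) \<longleftrightarrow> bij_betw (num \<circ> b) (elts X) (elts n)"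
    by (rule bij_betw_cong) (rule c)
  then show "finite_in X"
    unfolding finite_in_def natural_iff using bn c(1) n_def by blast
qed

text \<open>An involution that preserves a linear order is the identity. So a linearly orderable set
  is fixed pointwise by the stabilizer of one of its orders, and any subset or function on it
  from the ground universe belongs to the model.\<close>

lemma linearly_orderable_fixed:
  assumes "linearly_orderable X" "X \<in> Univ N"
  obtains m where "\<And>s x. s \<in> fix_blocks m \<Longrightarrow> x \<in> elts X \<Longrightarrow> T s x = x"
proof -
  obtain r where r: "is_relation r X X" "linear_order_on (elts X) (rel r)"
    using assms(1) unfolding linearly_orderable_def by blast
  have rU: "r \<in> Univ N" using r sets_Univ by (auto simp: is_relation_def)
  obtain m where m: "\<forall>s\<in>fix_blocks m. \<forall>x\<in>{X, r}. T s x = x"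
    using finite_support[of "{X, r}"] rU assms(2) by auto
  have "T s x = x" if s: "s \<in> fix_blocks m" and x: "x \<in> elts X" for s x
  proof (rule ccontr)
    assume neq: "T s x \<noteq> x"
    have Tx: "T s x \<in> elts X" "T s (T s x) = x"
      using m s x T_elts[OF assms(2)] T_T elts_Univ by auto
    have swap: "(T s a, T s b) \<in> rel r" if "(a, b) \<in> rel r" for a b
      using rel_T[OF rU] m s that by blast
    have "(x, T s x) \<in> rel r \<or> (T s x, x) \<in> rel r"
      using r(2) x Tx neq by (auto simp: linear_order_on_def total_on_def)
    then have "(x, T s x) \<in> rel r" "(T s x, x) \<in> rel r"
      using swap Tx by metis+
    then show False
      using r(2) neq by (auto simp: linear_order_on_def partial_order_on_def antisym_def)
  qed
  then show ?thesis using that by blast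
qed

end

section \<open>Cofinal sets and Kinna--Wegner functions\<close>

text \<open>As the group has exponent two, orbits are antichains, so a poset of the model with
  support \<open>m\<close> induces a partial order on its orbits.\<close>

locale supported_poset = klein_model N small T at
  for N :: "'v zfa_structure" and small T at +
  fixes P r :: 'v and m :: nat
  assumes poset: "is_poset P r"
    and fix_P: "s \<in> fix_blocks m \<Longrightarrow> T s P = P"
    and fix_r: "s \<in> fix_blocks m \<Longrightarrow> T s r = r"
begin

lemma P_Univ: "P \<in> Univ N"
  using poset sets_Univ by (simp add: is_poset_def)

lemma r_Univ: "r \<in> Univ N"
  using poset sets_Univ by (simp add: is_poset_def is_relation_def)

lemma r_P: "(x, y) \<in> rel r \<Longrightarrow> x \<in> elts P \<and> y \<in> elts P"
  using poset is_relation_subset unfolding is_poset_def by blast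

lemma r_refl: "x \<in> elts P \<Longrightarrow> (x, x) \<in> rel r"
  using poset by (auto simp: is_poset_def partial_order_on_def preorder_on_def refl_on_def)

lemma r_trans: "(x, y) \<in> rel r \<Longrightarrow> (y, z) \<in> rel r \<Longrightarrow> (x, z) \<in> rel r"
  using poset unfolding is_poset_def partial_order_on_def preorder_on_def by (blast dest: transD)

lemma r_antisym: "(x, y) \<in> rel r \<Longrightarrow> (y, x) \<in> rel r \<Longrightarrow> x = y"
  using poset unfolding is_poset_def partial_order_on_def by (blast dest: antisymD)

lemma r_T: "s \<in> fix_blocks m \<Longrightarrow> (x, y) \<in> rel r \<Longrightarrow> (T s x, T s y) \<in> rel r"
  using rel_T[OF r_Univ fix_r] by blast

lemma P_T: "s \<in> fix_blocks m \<Longrightarrow> x \<in> elts P \<Longrightarrow> T s x \<in> elts P"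
  using T_elts[OF P_Univ fix_P] by blast

definition orb :: "'v \<Rightarrow> 'v set" where
  "orb x = (\<lambda>s. T s x) ` fix_blocks m"

definition orb_le :: "'v set \<Rightarrow> 'v set \<Rightarrow> bool" where
  "orb_le A B \<longleftrightarrow> (\<exists>x\<in>A. \<exists>y\<in>B. (x, y) \<in> rel r)"

lemma orb_T:
  assumes s: "s \<in> fix_blocks m" and x: "x \<in> elts P"
  shows "orb (T s x) = orb x"
proof -
  have sub: "orb (T s y) \<subseteq> orb y" if "y \<in> elts P" for y
    using add_in_fix_blocks[OF _ s] T_add[OF elts_Univ[OF that]] by (auto simp: orb_def) (metis imageI)
  from sub[OF x] sub[OF P_T[OF s x]] show ?thesis
    using T_T[OF elts_Univ[OF x]] by auto
qed

text \<open>The order is invariant, so a comparison between orbits can be translated until its lower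
  end is the given representative; only the upper one has to move.\<close>

lemma orb_le_iff:
  assumes x: "x \<in> elts P" and y: "y \<in> elts P"
  shows "orb_le (orb x) (orb y) \<longleftrightarrow> (\<exists>s\<in>fix_blocks m. (x, T s y) \<in> rel r)"
proof
  assume "orb_le (orb x) (orb y)"
  then obtain s t where st: "s \<in> fix_blocks m" "t \<in> fix_blocks m" "(T s x, T t y) \<in> rel r"
    by (auto simp: orb_le_def orb_def)
  then have "(T s (T s x), T s (T t y)) \<in> rel r" by (intro r_T)
  then have "(x, T (add_shifts s t) y) \<in> rel r"
    using x y by (simp add: T_T T_add elts_Univ)
  then show "\<exists>s\<in>fix_blocks m. (x, T s y) \<in> rel r"
    using st add_in_fix_blocks by blast
next
  assume "\<exists>s\<in>fix_blocks m. (x, T s y) \<in> rel r"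
  moreover have "x \<in> orb x"
    unfolding orb_def by (rule image_eqI[OF _ zero_in_fix_blocks]) (simp add: T_zero elts_Univ[OF x])
  ultimately show "orb_le (orb x) (orb y)"
    unfolding orb_le_def orb_def by blast
qed

text \<open>Applying the involution \<open>T s\<close> to x <= s x yields s x <= x.\<close>

lemma antichain:
  assumes s: "s \<in> fix_blocks m" and le: "(x, T s x) \<in> rel r"
  shows "T s x = x"
  using r_T[OF s le] le r_antisym T_T[OF elts_Univ[of x P]] r_P by metis

lemma orb_leI: "(x, y) \<in> rel r \<Longrightarrow> orb_le (orb x) (orb y)"
  using orb_le_iff[of x y] r_P T_zero elts_Univ zero_in_fix_blocks by metis

lemma orb_le_refl: "A \<in> orb ` elts P \<Longrightarrow> orb_le A A"
  using orb_leI r_refl by auto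

lemma orb_le_trans:
  assumes "A \<in> orb ` elts P" "B \<in> orb ` elts P" "C \<in> orb ` elts P" "orb_le A B" "orb_le B C"
  shows "orb_le A C"
proof -
  obtain x y z where xyz: "x \<in> elts P" "y \<in> elts P" "z \<in> elts P" "A = orb x" "B = orb y" "C = orb z"
    using assms by auto
  obtain s t where st: "s \<in> fix_blocks m" "t \<in> fix_blocks m" "(x, T s y) \<in> rel r" "(y, T t z) \<in> rel r"
    using assms orb_le_iff xyz by auto
  have "(x, T (add_shifts s t) z) \<in> rel r"
    using r_trans[OF st(3) r_T[OF st(1,4)]] xyz by (simp add: T_add elts_Univ)
  then show ?thesis
    using orb_le_iff xyz st add_in_fix_blocks by blast
qed

text \<open>From x <= s y and y <= t x one gets x <= s y <= (s + t) x. The outer terms lie in one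
  orbit, hence coincide, and then x = s y.\<close>

lemma orb_le_antisym:
  assumes "A \<in> orb ` elts P" "B \<in> orb ` elts P" "orb_le A B" "orb_le B A"
  shows "A = B"
proof -
  obtain x y where xy: "x \<in> elts P" "y \<in> elts P" "A = orb x" "B = orb y"
    using assms by auto
  obtain s t where st: "s \<in> fix_blocks m" "t \<in> fix_blocks m" "(x, T s y) \<in> rel r" "(y, T t x) \<in> rel r"
    using assms orb_le_iff xy by auto
  have *: "(T s y, T (add_shifts s t) x) \<in> rel r"
    using r_T[OF st(1,4)] xy by (simp add: T_add elts_Univ)
  then have "T (add_shifts s t) x = x"
    using antichain[OF add_in_fix_blocks[OF st(1,2)]] r_trans[OF st(3)] by blast
  then have "T s y = x"
    using * st(3) r_antisym by simp
  then show ?thesis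
    using orb_T[OF st(1)] xy by metis
qed

text \<open>\<open>Q\<close> is an arbitrary HOL set of orbits, chosen outside the model. The union
  is nevertheless invariant under \<open>fix_blocks m\<close>, which permutes the points within each
  orbit.\<close>

lemma saturated_set_ex: "\<exists>C\<in>sets. elts C = {x \<in> elts P. orb x \<in> Q}"
proof (rule sets_ex[of _ m])
  show "small {x \<in> elts P. orb x \<in> Q}"
    by (rule small_subset[OF small_elts[OF P_Univ]]) simp
qed (use elts_Univ P_T orb_T in auto)

lemma saturated_cofinal:
  assumes "\<forall>A\<in>orb ` elts P. \<exists>B\<in>Q. orb_le A B" "Q \<subseteq> orb ` elts P"
    and C: "C \<in> sets" "elts C = {x \<in> elts P. orb x \<in> Q}"
  shows "cofinal C P r"
  unfolding cofinal_def
proof (intro conjI ballI)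
  fix p assume p: "p \<in> elts P"
  then obtain q where q: "q \<in> elts P" "orb q \<in> Q" "orb_le (orb p) (orb q)"
    using assms(1,2) by blast
  then obtain s where s: "s \<in> fix_blocks m" "(p, T s q) \<in> rel r"
    using orb_le_iff p by blast
  then have "T s q \<in> elts C"
    using q P_T orb_T C by simp
  with s show "\<exists>c\<in>elts C. (p, c) \<in> rel r" by blast
qed (use C in auto)

lemma disjoint_cofinal:
  assumes "\<not> (\<exists>p\<in>elts P. \<forall>x\<in>elts P. (p, x) \<in> rel r \<longrightarrow> x = p)"
  shows "\<exists>C D. cofinal C P r \<and> cofinal D P r \<and> elts C \<inter> elts D = {}"
proof -
  have "\<exists>Q R. Q \<subseteq> orb ` elts P \<and> R \<subseteq> orb ` elts P \<and> Q \<inter> R = {} \<and>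
    (\<forall>p\<in>orb ` elts P. \<exists>c\<in>Q. orb_le p c) \<and> (\<forall>p\<in>orb ` elts P. \<exists>d\<in>R. orb_le p d)"
  proof (rule ex_disjoint_cofinal[OF orb_le_refl orb_le_trans orb_le_antisym])
    fix A assume "A \<in> orb ` elts P"
    then obtain x where x: "x \<in> elts P" "A = orb x" by blast
    with assms obtain y where y: "y \<in> elts P" "(x, y) \<in> rel r" "y \<noteq> x" by blast
    \<comment> \<open>The orbit grows strictly: if \<open>y\<close> were in the orbit of
      \<open>x\<close>, then being above \<open>x\<close> it would equal \<open>x\<close>.\<close>
    have "orb y \<noteq> orb x"
    proof
      assume "orb y = orb x"
      moreover have "y \<in> orb y"
        unfolding orb_def by (rule image_eqI[OF _ zero_in_fix_blocks]) (simp add: T_zero elts_Univ[OF y(1)])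
      ultimately obtain s where "s \<in> fix_blocks m" "y = T s x" by (auto simp: orb_def)
      then show False using antichain y by blast
    qed
    with orb_leI[OF y(2)] x y show "\<exists>B\<in>orb ` elts P. orb_le A B \<and> B \<noteq> A" by blast
  qed
  then obtain Q R where Q: "Q \<subseteq> orb ` elts P" "\<forall>p\<in>orb ` elts P. \<exists>c\<in>Q. orb_le p c"
    and R: "R \<subseteq> orb ` elts P" "\<forall>p\<in>orb ` elts P. \<exists>d\<in>R. orb_le p d" and QR: "Q \<inter> R = {}"
    by (elim exE conjE) (rule that; assumption)
  obtain C D where C: "C \<in> sets" "elts C = {x \<in> elts P. orb x \<in> Q}"
    and D: "D \<in> sets" "elts D = {x \<in> elts P. orb x \<in> R}"
    using saturated_set_ex by metis
  have "elts C \<inter> elts D = {}" using C D QR by auto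
  then show ?thesis
    using saturated_cofinal[OF Q(2,1) C] saturated_cofinal[OF R(2,1) D] by blast
qed

lemma cofinal_well_founded: "\<exists>C. cofinal C P r \<and> well_founded C r"
proof -
  have "\<exists>Q w. Q \<subseteq> orb ` elts P \<and> wf w \<and> (\<forall>p\<in>orb ` elts P. \<exists>c\<in>Q. orb_le p c) \<and>
    (\<forall>x\<in>Q. \<forall>y\<in>Q. orb_le x y \<longrightarrow> x = y \<or> (x, y) \<in> w)"
    by (rule ex_cofinal_ranked[OF orb_le_refl orb_le_trans])
  then obtain Q w where Q: "Q \<subseteq> orb ` elts P" "\<forall>p\<in>orb ` elts P. \<exists>c\<in>Q. orb_le p c"
    and w: "wf w" "\<forall>x\<in>Q. \<forall>y\<in>Q. orb_le x y \<longrightarrow> x = y \<or> (x, y) \<in> w"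
    by (elim exE conjE) (rule that; assumption)
  obtain C where C: "C \<in> sets" "elts C = {x \<in> elts P. orb x \<in> Q}"
    using saturated_set_ex by metis
  have "well_founded C r"
    unfolding well_founded_def
  proof (intro ballI impI, elim conjE)
    fix X assume X: "elts X \<subseteq> elts C" "elts X \<noteq> {}"
    then obtain x where "orb x \<in> orb ` elts X" by blast
    \<comment> \<open>The ranking \<open>w\<close> lives in the metalogic; only its consequence for
      sets of the model is wanted. A point of \<open>X\<close> below a point \<open>a\<close> of a
      \<open>w\<close>-minimal orbit has the same orbit as \<open>a\<close>, and orbits are
      antichains.\<close>
    from wfE_min[OF w(1) this] obtain A where A: "A \<in> orb ` elts X"
      "\<And>B. (B, A) \<in> w \<Longrightarrow> B \<notin> orb ` elts X" by blast
    then obtain a where a: "a \<in> elts X" "A = orb a" by blast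
    have "x = a" if x: "x \<in> elts X" and le: "(x, a) \<in> rel r" for x
    proof -
      have "orb x = orb a"
        using w(2)[rule_format, of "orb x" "orb a"] orb_leI[OF le] A(2)[of "orb x"] a x X C by auto
      moreover have "a \<in> orb a"
        unfolding orb_def
        by (rule image_eqI[OF _ zero_in_fix_blocks]) (simp add: T_zero elts_Univ[OF a(1)])
      ultimately obtain s where "s \<in> fix_blocks m" "a = T s x" by (auto simp: orb_def)
      then show ?thesis using antichain le by metis
    qed
    with a show "\<exists>m\<in>elts X. \<forall>x\<in>elts X. (x, m) \<in> rel r \<longrightarrow> x = m" by blast
  qed
  then show ?thesis using saturated_cofinal[OF Q(2,1) C] by blast
qed

end

context klein_model
begin

lemma supported_posetE:
  assumes "is_poset P r"
  obtains m where "supported_poset N small T at P r m"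
proof -
  have "P \<in> Univ N" "r \<in> Univ N"
    using assms sets_Univ by (auto simp: is_poset_def is_relation_def)
  then obtain m where m: "\<forall>s\<in>fix_blocks m. \<forall>x\<in>{P, r}. T s x = x"
    using finite_support[of "{P, r}"] by auto
  have "supported_poset N small T at P r m"
    by unfold_locales (use assms m in auto)
  then show ?thesis by (rule that)
qed

lemma CS: CS
  unfolding CS_def using supported_posetE supported_poset.disjoint_cofinal by metis

lemma CWF: CWF
  unfolding CWF_def using supported_posetE supported_poset.cofinal_well_founded by metis

lemma not_LOKW4_minus: "\<not> LOKW4_minus"
proof
  assume LOKW: LOKW4_minus
  define B where "B n = at ` ({n} \<times> UNIV)" for n
  define block where "block n = set_of (B n)" for n
  have finB: "finite (B n)" for n by (simp add: B_def)
  have "B n \<subseteq> Univ N" for n using at_Univ by (auto simp: B_def)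
  with finB have block: "block n \<in> sets" "elts (block n) = B n" for n
    unfolding block_def using set_of[OF finite_set_ex[of "B n"]] by blast+
  have TB: "T s ` B n = B n" for s n
  proof -
    have sub: "T s x \<in> B n" if "x \<in> B n" for x
      using that by (auto simp: B_def T_at shift_def)
    moreover have "x \<in> T s ` B n" if "x \<in> B n" for x
      using imageI[OF sub[OF that], of "T s"] that at_Univ by (auto simp: B_def T_T)
    ultimately show ?thesis by blast
  qed
  \<comment> \<open>Shifts permute the points within a block but fix the block as a set, so the
    family of blocks and its order by index have support 0.\<close>
  have Tblock: "T s (block n) = block n" for s n
    by (intro T_set_eqI block) (simp add: block TB)
  have inj_block: "block i = block j \<longleftrightarrow> i = j" for i j
  proof
    assume "block i = block j"
    then have "B i = B j" using block(2) by metis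
    moreover have "at (i, True, True) \<in> B i" by (auto simp: B_def)
    ultimately show "i = j" using inj_at by (auto simp: B_def inj_eq)
  qed simp
  have bU: "block n \<in> Univ N" for n using block sets_Univ by blast
  obtain \<A> where A: "\<A> \<in> sets" "elts \<A> = range block"
  proof -
    have "small (range block)" using bU by (intro small_range) auto
    then have "\<exists>x\<in>sets. elts x = range block"
      by (rule sets_ex[of _ 0]) (use bU Tblock in auto)
    then show ?thesis using that by blast
  qed
  have "\<not> finite_in \<A>"
    using A finite_in_iff[OF sets_Univ] inj_block by (auto simp: finite_image_iff inj_on_def)
  moreover have "linearly_orderable \<A>"
  proof -
    define R where "R = {(block i, block j) |i j. i \<le> j}"
    have RA: "R \<subseteq> elts \<A> \<times> elts \<A>" by (auto simp: R_def A)
    obtain r where r: "is_relation r \<A> \<A>" "rel r = R"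
      by (rule encode_rel[OF sets_Univ[OF A(1)] sets_Univ[OF A(1)] RA, of 0])
        (auto simp: R_def Tblock inj_block)
    have "linear_order_on (elts \<A>) R"
      unfolding linear_order_on_def partial_order_on_def preorder_on_def
    proof (intro conjI)
      show "refl_on (elts \<A>) R" using RA by (auto simp: refl_on_def R_def A)
      show "trans R" by (fastforce simp: trans_def R_def inj_block)
      show "antisym R" by (auto simp: antisym_def R_def inj_block)
      show "total_on (elts \<A>) R" by (auto simp: total_on_def R_def A inj_block)
      show "R \<subseteq> elts \<A> \<times> elts \<A>" by (rule RA)
    qed
    with r show ?thesis by (auto simp: linearly_orderable_def)
  qed
  moreover have "card (elts X) = 4" if X: "X \<in> elts \<A>" for X
  proof -
    obtain n where n: "elts X = B n" using X by (auto simp: A block)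
    show ?thesis
      unfolding n B_def using inj_on_subset[OF inj_at subset_UNIV]
      by (simp add: card_image card_cartesian_product flip: UNIV_Times_UNIV)
  qed
  ultimately obtain \<B> f Y where B: "\<B> \<in> sets" "elts \<B> \<subseteq> elts \<A>" "\<not> finite_in \<B>"
    and f: "is_function f \<B> Y"
      "\<forall>B\<in>elts \<B>. app f B \<in> sets \<and> elts (app f B) \<noteq> {} \<and> elts (app f B) \<subset> elts B"
    using LOKW A(1) unfolding LOKW4_minus_def by blast
  obtain m where m: "\<forall>s\<in>fix_blocks m. \<forall>x\<in>{\<B>, f}. T s x = x"
    using finite_support[of "{\<B>, f}"] is_function_Univ[OF f(1)] sets_Univ[OF B(1)] by auto
  \<comment> \<open>Only finitely many blocks meet the support \<open>m\<close>, so an infinite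
    subfamily has a block beyond it.\<close>
  obtain n where n: "n \<ge> m" "block n \<in> elts \<B>"
  proof -
    have "\<not> elts \<B> \<subseteq> block ` {..<m}"
      using finite_subset[of "elts \<B>" "block ` {..<m}"] B finite_in_iff[OF sets_Univ] by auto
    then obtain X where X: "X \<in> elts \<B>" "X \<notin> block ` {..<m}" by blast
    with B A obtain n where "X = block n" by auto
    with X that[of n] show ?thesis by (cases "n < m") auto
  qed
  define F where "F = app f (block n)"
  have F: "F \<in> sets" "elts F \<noteq> {}" "elts F \<subset> B n"
    using f(2)[rule_format, OF n(2)] unfolding F_def block(2) by blast+
  \<comment> \<open>Both \<open>f\<close> and the block are fixed by these shifts, hence so is the
    selected subset.\<close>
  have TF: "T s F = F" if s: "s \<in> fix_blocks m" for s
    using app_T[OF f(1) _ sets_Univ[OF B(1)] _ n(2)] m s by (simp add: F_def Tblock)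
  obtain x y where "x \<in> elts F" "x \<in> B n" "y \<in> B n" "y \<notin> elts F"
    using F by blast
  then obtain a b c d where ab: "at (n, a, b) \<in> elts F" and cd: "at (n, c, d) \<notin> elts F"
    by (auto simp: B_def)
  \<comment> \<open>The shift that is trivial outside block \<open>n\<close> and there adds the
    difference of the two labels: it takes a selected atom to one that is not selected.\<close>
  define s where "s = (\<lambda>k. if k = n then (a \<noteq> c, b \<noteq> d) else (False, False))"
  have "s \<in> fix_blocks m" using n by (auto simp: s_def fix_blocks_def)
  then have "T s (at (n, a, b)) \<in> elts F"
    using TF T_elts[OF sets_Univ[OF F(1)] _ ab] by blast
  moreover have "T s (at (n, a, b)) = at (n, c, d)"
    by (auto simp: T_at shift_def s_def inj_eq[OF inj_at])
  ultimately show False using cd by simp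
qed

end

section \<open>Graphs and vector spaces\<close>

context klein_model
begin

lemma edge_sym: "edge E x y \<Longrightarrow> edge E y x"
  unfolding edge_def by (simp add: insert_commute)

lemma edge_T:
  assumes "E \<in> Univ N" "T s E = E" "edge E x y"
  shows "edge E (T s x) (T s y)"
proof -
  obtain e where e: "e \<in> elts E" "elts e = {x, y}"
    using assms(3) unfolding edge_def by blast
  have "T s e \<in> elts E" "elts (T s e) = {T s x, T s y}"
    using T_elts[OF assms(1,2) e(1)] elts_T[OF elts_Univ[OF e(1)]] e(2) by auto
  then show ?thesis unfolding edge_def by blast
qed

lemma graph_edge:
  assumes "graph V E" "edge E x y"
  shows "x \<in> elts V" "y \<in> elts V"
proof -
  obtain e where e: "e \<in> elts E" "elts e = {x, y}"
    using assms(2) unfolding edge_def by blast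
  then obtain a b where "a \<in> elts V" "b \<in> elts V" "elts e = {a, b}"
    using assms(1) unfolding graph_def by blast
  with e show "x \<in> elts V" "y \<in> elts V" by auto
qed

lemma graph_Univ: "graph V E \<Longrightarrow> V \<in> Univ N \<and> E \<in> Univ N"
  using sets_Univ by (simp add: graph_def)

text \<open>Finite collections always belong to the model. The edges inside \<open>W\<close> are
  finitely many because, being nonempty sets and not atoms, they are determined by their
  endpoints.\<close>

lemma finite_induced_subgraph:
  assumes "graph V E" "finite W" "W \<subseteq> elts V"
  obtains V' E' where "graph V' E'" "finite_in V'" "elts V' = W" "elts E' \<subseteq> elts E"
    "\<And>x y. x \<in> W \<Longrightarrow> y \<in> W \<Longrightarrow> edge E x y \<Longrightarrow> edge E' x y"
proof -
  define D where "D = {e \<in> elts E. elts e \<subseteq> W}"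
  have sets: "e \<in> sets" if "e \<in> elts E" for e
  proof -
    have "elts e \<noteq> {}" using assms(1) that unfolding graph_def by blast
    then show ?thesis using that elts_Univ by (intro setsI)
  qed
  then have "inj_on elts D"
    using extensionality by (auto simp: inj_on_def D_def)
  moreover have "finite (elts ` D)"
    by (rule finite_subset[of _ "Pow W"]) (use assms(2) in \<open>auto simp: D_def\<close>)
  ultimately have "finite D" by (rule finite_imageD[rotated])
  moreover have "D \<subseteq> Univ N" using elts_Univ by (auto simp: D_def)
  ultimately obtain E' where E': "E' \<in> in_structure.sets N" "elts E' = D"
    using finite_set_ex by blast
  obtain V' where V': "V' \<in> in_structure.sets N" "elts V' = W"
    using finite_set_ex[OF assms(2)] assms(3) elts_subset_Univ by blast
  show ?thesis
  proof (rule that)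
    show "graph V' E'"
      unfolding graph_def
    proof (intro conjI ballI V'(1) E'(1))
      fix e assume "e \<in> elts E'"
      then have e: "e \<in> elts E" "elts e \<subseteq> W" by (auto simp: E' D_def)
      then obtain x y where "x \<noteq> y" "elts e = {x, y}"
        using assms(1) unfolding graph_def by blast
      with e show "\<exists>x\<in>elts V'. \<exists>y\<in>elts V'. x \<noteq> y \<and> elts e = {x, y}"
        by (auto simp: V')
    qed
    show "finite_in V'" using finite_in_iff[OF sets_Univ[OF V'(1)]] V' assms(2) by simp
    show "elts V' = W" by (rule V')
    show "elts E' \<subseteq> elts E" by (auto simp: E' D_def)
    show "edge E' x y" if "x \<in> W" "y \<in> W" "edge E x y" for x y
      using that by (auto simp: edge_def E' D_def)
  qed
qed

lemma homomorphism_compactness: homomorphism_compactness_statement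
  unfolding homomorphism_compactness_statement_def
proof (intro allI impI, elim conjE)
  fix V E W D
  assume VE: "graph V E" and lin: "linearly_orderable V" and WD: "graph W D" "finite_in W"
    and fin: "\<forall>V' E'. graph V' E' \<and> finite_in V' \<and> elts V' \<subseteq> elts V \<and> elts E' \<subseteq> elts E \<longrightarrow>
      homomorphic V' E' W D"
  have VU: "V \<in> Univ N" and WU: "W \<in> Univ N"
    using graph_Univ VE WD(1) by blast+
  have finW: "finite (elts W)" using WD(2) finite_in_iff[OF WU] by simp
  obtain m where m: "\<And>s x. s \<in> fix_blocks m \<Longrightarrow> x \<in> elts V \<Longrightarrow> T s x = x"
    by (rule linearly_orderable_fixed[OF lin VU]) blast
  obtain n where n: "\<forall>s\<in>fix_blocks n. \<forall>x\<in>elts W. T s x = x"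
    using finite_support[OF finW elts_subset_Univ] by blast
  have "\<exists>h. (\<forall>x\<in>elts V. h x \<in> elts W) \<and>
    (\<forall>x\<in>elts V. \<forall>y\<in>elts V. edge E x y \<longrightarrow> edge D (h x) (h y))"
  proof (rule finite_target_compactness[OF finW])
    fix X assume X: "finite X" "X \<subseteq> elts V"
    obtain V' E' where V': "graph V' E'" "finite_in V'" "elts V' = X" "elts E' \<subseteq> elts E"
      and E': "\<And>x y. x \<in> X \<Longrightarrow> y \<in> X \<Longrightarrow> edge E x y \<Longrightarrow> edge E' x y"
      by (rule finite_induced_subgraph[OF VE X]) blast
    have "homomorphic V' E' W D" using fin V' X(2) by simp
    then obtain h where h: "is_function h V' W"
      "\<forall>x\<in>X. \<forall>y\<in>X. edge E' x y \<longrightarrow> edge D (app h x) (app h y)"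
      unfolding homomorphic_def V'(3) by blast
    have "\<forall>x\<in>X. app h x \<in> elts W" using is_functionD(2)[OF h(1)] V'(3) by blast
    then show "\<exists>h. (\<forall>x\<in>X. h x \<in> elts W) \<and>
      (\<forall>x\<in>X. \<forall>y\<in>X. edge E x y \<longrightarrow> edge D (h x) (h y))"
      using h(2) E' by (intro exI[of _ "app h"]) blast
  qed
  then obtain h where h: "\<And>x. x \<in> elts V \<Longrightarrow> h x \<in> elts W"
    "\<And>x y. x \<in> elts V \<Longrightarrow> y \<in> elts V \<Longrightarrow> edge E x y \<Longrightarrow> edge D (h x) (h y)"
    by blast
  \<comment> \<open>Beyond both supports all vertices of both graphs are fixed, so every HOL map
    between them is equivariant.\<close>
  have inv: "h (T s x) = T s (h x)" if s: "s \<in> fix_blocks (max m n)" and x: "x \<in> elts V" for s x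
  proof -
    have "s \<in> fix_blocks m" "s \<in> fix_blocks n" using s fix_blocks_mono by auto
    then show ?thesis using m n h(1) x by simp
  qed
  obtain c where "is_function c V W" "\<And>x. x \<in> elts V \<Longrightarrow> app c x = h x"
    by (rule encode_fun[OF VU WU h(1) inv]) blast+
  then show "homomorphic V E W D"
    unfolding homomorphic_def using h(2) by auto
qed

lemma linear_functional: linear_functional_statement
  unfolding linear_functional_statement_def
proof (intro allI impI, elim conjE)
  fix F aF mF zF iF V aV zV sV
  assume F: "F \<in> sets" and fld: "field (ring_of F aF mF zF iF)" and fin: "finite_in F"
    and V: "V \<in> sets" and mod: "module (ring_of F aF mF zF iF) (module_of V aV zV sV)"
    and "\<exists>v\<in>elts V. v \<noteq> zV" and lin: "linearly_orderable V"
  then obtain v where v: "v \<in> elts V" "v \<noteq> zV" by blast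
  interpret M: module "ring_of F aF mF zF iF" "module_of V aV zV sV" by (rule mod)
  have "\<exists>f. (\<forall>x\<in>elts V. f x \<in> elts F) \<and>
    (\<forall>x\<in>elts V. \<forall>y\<in>elts V. f (app2 aV x y) = app2 aF (f x) (f y)) \<and>
    (\<forall>c\<in>elts F. \<forall>x\<in>elts V. f (app2 sV c x) = app2 mF c (f x)) \<and> f v = iF"
    using ex_linear_functional[OF fld mod, of v] v by (simp add: ring_of_def module_of_def)
  then obtain f where f: "\<And>x. x \<in> elts V \<Longrightarrow> f x \<in> elts F"
    "\<And>x y. x \<in> elts V \<Longrightarrow> y \<in> elts V \<Longrightarrow> f (app2 aV x y) = app2 aF (f x) (f y)"
    "\<And>c x. c \<in> elts F \<Longrightarrow> x \<in> elts V \<Longrightarrow> f (app2 sV c x) = app2 mF c (f x)" "f v = iF"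
    by blast
  have "iF \<noteq> zF"
    using fld domain.one_not_zero[of "ring_of F aF mF zF iF"] field.axioms(1) by (auto simp: ring_of_def)
  have closed: "app2 aV x y \<in> elts V" "c \<in> elts F \<Longrightarrow> app2 sV c x \<in> elts V"
    if "x \<in> elts V" "y \<in> elts V" for x y c
    using M.M.a_closed[of x y] M.smult_closed[of c x] that by (simp_all add: module_of_def ring_of_def)
  obtain m where m: "\<And>s x. s \<in> fix_blocks m \<Longrightarrow> x \<in> elts V \<Longrightarrow> T s x = x"
    by (rule linearly_orderable_fixed[OF lin sets_Univ[OF V]]) blast
  have "finite (elts F)" using fin finite_in_iff[OF sets_Univ[OF F]] by simp
  then obtain n where n: "\<forall>s\<in>fix_blocks n. \<forall>x\<in>elts F. T s x = x"
    using finite_support[OF _ elts_subset_Univ] by blast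
  \<comment> \<open>The vectors are fixed by linear orderability and the scalars by finiteness, so
    the functional found in the metalogic is equivariant.\<close>
  have inv: "f (T s x) = T s (f x)" if s: "s \<in> fix_blocks (max m n)" and x: "x \<in> elts V" for s x
  proof -
    have "s \<in> fix_blocks m" "s \<in> fix_blocks n" using s fix_blocks_mono by auto
    then show ?thesis using m n f(1) x by simp
  qed
  obtain c where c: "is_function c V F" "\<And>x. x \<in> elts V \<Longrightarrow> app c x = f x"
    by (rule encode_fun[OF sets_Univ[OF V] sets_Univ[OF F] f(1) inv]) blast+
  show "\<exists>f. is_function f V F \<and>
    (\<forall>x\<in>elts V. \<forall>y\<in>elts V. app f (app2 aV x y) = app2 aF (app f x) (app f y)) \<and>
    (\<forall>c\<in>elts F. \<forall>x\<in>elts V. app f (app2 sV c x) = app2 mF c (app f x)) \<and>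
    (\<exists>v\<in>elts V. app f v \<noteq> zF)"
  proof (intro exI[of _ c] conjI ballI c(1) bexI[of _ v] v(1))
    show "app c v \<noteq> zF" using c(2) f(4) v(1) \<open>iF \<noteq> zF\<close> by simp
  qed (simp_all add: c(2) f closed)
qed

section \<open>Products of graphs and their colorings\<close>

lemma product_graph_ex:
  assumes "graph V1 E1" "graph V2 E2"
  obtains V E where "product_graph V E V1 E1 V2 E2"
proof -
  have U: "V1 \<in> Univ N" "E1 \<in> Univ N" "V2 \<in> Univ N" "E2 \<in> Univ N"
    using graph_Univ assms by blast+
  define X where "X = {p. \<exists>x\<in>elts V1. \<exists>y\<in>elts V2. is_pair p x y}"
  have X_eq: "X = (\<lambda>(x, y). pr x y) ` (elts V1 \<times> elts V2)"
    unfolding X_def is_pair_iff using elts_Univ by auto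
  have "\<exists>V\<in>sets. elts V = X"
  proof (rule ex_set_finite_support[where A = "{V1, V2}"])
    show "small X"
      unfolding X_eq by (intro small_pairs small_elts elts_subset_Univ U)
    show "X \<subseteq> Univ N" using is_pair_Univ by (auto simp: X_def)
    fix s p assume s: "\<And>a. a \<in> {V1, V2} \<Longrightarrow> T s a = a" and "p \<in> X"
    then obtain x y where xy: "x \<in> elts V1" "y \<in> elts V2" "p = pr x y"
      by (auto simp: X_eq)
    then have "T s p = pr (T s x) (T s y)" using T_pr elts_Univ by simp
    moreover have "T s x \<in> elts V1" "T s y \<in> elts V2" using s U xy T_elts by auto
    ultimately show "T s p \<in> X" by (auto simp: X_eq)
  qed (use U in auto)
  then obtain V where V: "V \<in> sets" "elts V = X" by blast
  define Y where "Y = {e \<in> Univ N. \<exists>p q x0 x1 y0 y1.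
      is_pair p x0 x1 \<and> is_pair q y0 y1 \<and> edge E1 x0 y0 \<and> edge E2 x1 y1 \<and> elts e = {p, q}}"
  have "\<exists>E\<in>sets. elts E = Y"
  proof (rule ex_set_finite_support[where A = "{E1, E2}"])
    \<comment> \<open>Edges of the product are sets of its vertices, so they lie in the power set of
      the vertex set, which is small.\<close>
    have "Y \<subseteq> {e \<in> sets. elts e \<subseteq> elts V}"
    proof
      fix e assume "e \<in> Y"
      then obtain p q x0 x1 y0 y1 where e: "e \<in> Univ N" "is_pair p x0 x1" "is_pair q y0 y1"
        "edge E1 x0 y0" "edge E2 x1 y1" "elts e = {p, q}" unfolding Y_def by blast
      have "p \<in> X" "q \<in> X"
        unfolding X_def using e graph_edge[OF assms(1) e(4)] graph_edge[OF assms(2) e(5)] by blast+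
      then show "e \<in> {e \<in> sets. elts e \<subseteq> elts V}"
        using e V setsI[OF e(1)] by simp
    qed
    then show "small Y"
      by (rule small_subset[rotated]) (intro small_Pow small_elts sets_Univ V)
    show "Y \<subseteq> Univ N" by (auto simp: Y_def)
    fix s e assume s: "\<And>a. a \<in> {E1, E2} \<Longrightarrow> T s a = a" and "e \<in> Y"
    then obtain p q x0 x1 y0 y1 where e: "e \<in> Univ N" "is_pair p x0 x1" "is_pair q y0 y1"
        "edge E1 x0 y0" "edge E2 x1 y1" "elts e = {p, q}" unfolding Y_def by blast
    have "is_pair (T s p) (T s x0) (T s x1)" "is_pair (T s q) (T s y0) (T s y1)"
      using e(2,3) by (auto simp: is_pair_iff T_pr T_Univ)
    moreover have "edge E1 (T s x0) (T s y0)" "edge E2 (T s x1) (T s y1)"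
      using edge_T U s e by auto
    moreover have "elts (T s e) = {T s p, T s q}" "T s e \<in> Univ N"
      using e elts_T T_Univ by auto
    ultimately show "T s e \<in> Y" unfolding Y_def by blast
  qed (use U in auto)
  then obtain E where E: "E \<in> sets" "elts E = Y" by blast
  have "product_graph V E V1 E1 V2 E2"
    unfolding product_graph_def is_product_def using V E by (simp add: X_def Y_def)
  then show ?thesis by (rule that)
qed

text \<open>An unordered edge may list its ends in either order; swapping both factor edges as well
  covers the second case.\<close>

lemma product_graph_edge:
  assumes "product_graph V E V1 E1 V2 E2"
  shows "edge E p q \<longleftrightarrow> (\<exists>x0 x1 y0 y1.
    is_pair p x0 x1 \<and> is_pair q y0 y1 \<and> edge E1 x0 y0 \<and> edge E2 x1 y1)" (is "_ \<longleftrightarrow> ?R")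
proof
  assume "edge E p q"
  then obtain e where "e \<in> elts E" "elts e = {p, q}" unfolding edge_def by blast
  with assms obtain p' q' x0 x1 y0 y1 where e: "is_pair p' x0 x1" "is_pair q' y0 y1"
        "edge E1 x0 y0" "edge E2 x1 y1" "{p, q} = {p', q'}"
    unfolding product_graph_def by auto
  then have "p = p' \<and> q = q' \<or> p = q' \<and> q = p'" by (simp add: doubleton_eq_iff)
  then show ?R
  proof
    assume "p = q' \<and> q = p'"
    then show ?R using e edge_sym by blast
  qed (use e in blast)
next
  assume R: ?R
  then have "p \<in> Univ N" "q \<in> Univ N" using is_pair_Univ by blast+
  then obtain e where e: "e \<in> sets" "elts e = {p, q}"
    using finite_set_ex[of "{p, q}"] by auto
  moreover have "e \<in> elts E"
  proof -
    have "elts E = {e \<in> Univ N. \<exists>p q x0 x1 y0 y1.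
      is_pair p x0 x1 \<and> is_pair q y0 y1 \<and> edge E1 x0 y0 \<and> edge E2 x1 y1 \<and> elts e = {p, q}}"
      using assms by (simp add: product_graph_def)
    then show ?thesis using R e(2) sets_Univ[OF e(1)] by blast
  qed
  ultimately show "edge E p q" unfolding edge_def by blast
qed

lemma product_graph_vertex:
  assumes "product_graph V E V1 E1 V2 E2"
  shows "p \<in> elts V \<longleftrightarrow> (\<exists>x\<in>elts V1. \<exists>y\<in>elts V2. p = pr x y)"
proof -
  have "elts V = {p. \<exists>x\<in>elts V1. \<exists>y\<in>elts V2. is_pair p x y}"
    using assms by (simp add: product_graph_def is_product_def)
  then show ?thesis using elts_Univ by (auto simp: is_pair_iff)
qed

text \<open>A good coloring of the first factor is composed with the first projection. The
  projection commutes with shifts, so supports of \<open>V1\<close> and of the coloring support the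
  composite.\<close>

lemma colorable_product_of_factor:
  assumes prod: "product_graph V E V1 E1 V2 E2" and V1: "V1 \<in> sets"
    and k: "k \<in> Univ N" and col: "colorable V1 E1 k"
  shows "colorable V E k"
proof -
  obtain f where f: "is_function f V1 k"
    "\<forall>x\<in>elts V1. \<forall>y\<in>elts V1. edge E1 x y \<longrightarrow> app f x \<noteq> app f y"
    using col unfolding colorable_def by blast
  have VU: "V \<in> Univ N"
    using prod sets_Univ by (simp add: product_graph_def is_product_def)
  define first where "first p = (THE x. \<exists>y. is_pair p x y)" for p
  have first: "first p = x" if "is_pair p x y" for p x y
    unfolding first_def using that is_pair_inj by blast
  obtain m where m: "\<forall>s\<in>fix_blocks m. \<forall>x\<in>{V1, f}. T s x = x"
    using finite_support[of "{V1, f}"] is_function_Univ[OF f(1)] sets_Univ[OF V1] by auto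
  obtain c where c: "is_function c V k" "\<And>p. p \<in> elts V \<Longrightarrow> app c p = app f (first p)"
  proof (rule encode_fun[OF VU k, of "\<lambda>p. app f (first p)" m])
    fix p assume "p \<in> elts V"
    then obtain x y where p: "x \<in> elts V1" "y \<in> elts V2" "p = pr x y"
      using product_graph_vertex[OF prod] by blast
    then have p': "is_pair p x y" using is_pair_pr elts_Univ by simp
    then show "app f (first p) \<in> elts k"
      using is_functionD(2)[OF f(1) p(1)] by (simp add: first)
    fix s assume s: "s \<in> fix_blocks m"
    have "is_pair (T s p) (T s x) (T s y)"
      using p' by (simp add: is_pair_iff T_pr T_Univ)
    then show "app f (first (T s p)) = T s (app f (first p))"
      using app_T[OF f(1) _ sets_Univ[OF V1] _ p(1)] m s first[OF p'] by (simp add: first)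
  qed blast
  have "app c p \<noteq> app c q" if pq: "p \<in> elts V" "q \<in> elts V" "edge E p q" for p q
  proof -
    obtain x0 x1 y0 y1 where e: "is_pair p x0 x1" "is_pair q y0 y1" "edge E1 x0 y0"
      using pq(3) product_graph_edge[OF prod] by blast
    have "x0 \<in> elts V1" "y0 \<in> elts V1"
      using pq(1,2) e product_graph_vertex[OF prod] is_pair_inj is_pair_pr elts_Univ by metis+
    with e f(2) show ?thesis by (simp add: c(2) pq first)
  qed
  with c(1) show ?thesis unfolding colorable_def by blast
qed

text \<open>Given a coloring of the product with \<open>i\<close> colors and a finite \<open>W \<subseteq> V1\<close>, the colorings
  of \<open>W\<close> induced by the vertices of the second graph form a finite set. If that graph has no
  finite coloring, then two adjacent vertices induce the same coloring, which is then good.\<close>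

lemma colorable_factor_of_product:
  assumes prod: "product_graph V E V1 E1 V2 E2" and V1: "graph V1 E1" and V2: "graph V2 E2"
    and lin: "linearly_orderable V1" and inf: "chromatic_number_infinite V2 E2"
    and col: "colorable V E (num i)"
  shows "colorable V1 E1 (num i)"
proof -
  have V1U: "V1 \<in> Univ N" and V2U: "V2 \<in> Univ N"
    using graph_Univ V1 V2 by blast+
  have VU: "V \<in> Univ N"
    using prod sets_Univ by (simp add: product_graph_def is_product_def)
  obtain m where m: "\<And>s x. s \<in> fix_blocks m \<Longrightarrow> x \<in> elts V1 \<Longrightarrow> T s x = x"
    by (rule linearly_orderable_fixed[OF lin V1U]) blast
  obtain f where f: "is_function f V (num i)"
    "\<And>p q. p \<in> elts V \<Longrightarrow> q \<in> elts V \<Longrightarrow> edge E p q \<Longrightarrow> app f p \<noteq> app f q"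
    using col unfolding colorable_def by blast
  obtain n where n: "\<forall>s\<in>fix_blocks n. \<forall>x\<in>{V, f}. T s x = x"
    using finite_support[of "{V, f}"] is_function_Univ[OF f(1)] VU by auto
  define ix where "ix y x = inv_into UNIV num (app f (pr x y))" for x y
  have pV: "pr x y \<in> elts V" if "x \<in> elts V1" "y \<in> elts V2" for x y
    using product_graph_vertex[OF prod] that by blast
  have ix: "ix y x < i" "app f (pr x y) = num (ix y x)" if "x \<in> elts V1" "y \<in> elts V2" for x y
    using is_functionD(2)[OF f(1) pV[OF that]] by (auto simp: elts_num ix_def inj_num)
  have "\<exists>g. (\<forall>x\<in>elts V1. g x \<in> {..<i}) \<and> (\<forall>x\<in>elts V1. \<forall>y\<in>elts V1. edge E1 x y \<longrightarrow> g x \<noteq> g y)"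
  proof (rule finite_target_compactness)
    fix W assume W: "finite W" "W \<subseteq> elts V1"
    define C where "C = (\<Pi>\<^sub>E x\<in>W. {..<i})"
    have "finite C" unfolding C_def using W by (intro finite_PiE) auto
    then obtain b where b: "bij_betw b C {..<card C}"
      using ex_bij_betw_finite_nat[of C] by (auto simp: atLeast0LessThan)
    define h where "h y = restrict (ix y) W" for y
    have hC: "h y \<in> C" if "y \<in> elts V2" for y
      using ix that W(2) by (auto simp: h_def C_def)
    \<comment> \<open>The points of \<open>W\<close> and the colors are fixed by these shifts, so
      moving \<open>y\<close> does not change the coloring it induces. This puts the map from
      \<open>y\<close> to its induced coloring into the model.\<close>
    have h_T: "h (T s y) = h y" if s: "s \<in> fix_blocks (max m n)" and y: "y \<in> elts V2" for s y
    proof -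
      have s': "s \<in> fix_blocks m" "s \<in> fix_blocks n" using s fix_blocks_mono by auto
      have "app f (pr x (T s y)) = app f (pr x y)" if x: "x \<in> W" for x
      proof -
        have x1: "x \<in> elts V1" using x W by blast
        have "pr x (T s y) = T s (pr x y)"
          using T_pr m[OF s'(1) x1] elts_Univ[OF x1] elts_Univ[OF y] by simp
        then have "app f (pr x (T s y)) = T s (app f (pr x y))"
          using app_T[OF f(1) _ VU _ pV[OF x1 y]] n s'(2) by simp
        then show ?thesis using ix(2)[OF x1 y] T_num by simp
      qed
      then show ?thesis by (auto simp: h_def ix_def)
    qed
    \<comment> \<open>The finitely many possible colorings of \<open>W\<close> are numbered and used
      as colors for the second graph.\<close>
    obtain c where c: "is_function c V2 (num (card C))" "\<And>y. y \<in> elts V2 \<Longrightarrow> app c y = num (b (h y))"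
    proof (rule encode_fun[OF V2U num_Univ, of "\<lambda>y. num (b (h y))"])
      show "num (b (h y)) \<in> elts (num (card C))" if "y \<in> elts V2" for y
        using bij_betw_apply[OF b hC[OF that]] by (simp add: elts_num)
      show "num (b (h (T s y))) = T s (num (b (h y)))"
        if "s \<in> fix_blocks (max m n)" "y \<in> elts V2" for s y
        using h_T[OF that] by (simp add: T_num)
    qed blast
    have "\<not> colorable V2 E2 (num (card C))"
      using inf natural_iff unfolding chromatic_number_infinite_def by blast
    then obtain y z where yz: "y \<in> elts V2" "z \<in> elts V2" "edge E2 y z" "app c y = app c z"
      using c(1) unfolding colorable_def by blast
    then have "b (h y) = b (h z)" using c(2) inj_num by (simp add: inj_eq)
    then have hyz: "h y = h z"
      using bij_betw_imp_inj_on[OF b] hC yz by (auto simp: inj_on_def)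
    \<comment> \<open>Edges from \<open>x\<close> to \<open>x'\<close> and from \<open>y\<close> to
      \<open>z\<close> give a product edge from \<open>(x, y)\<close> to \<open>(x', z)\<close>. Its
      ends have different colors, and the color of \<open>(x', z)\<close> is that of
      \<open>(x', y)\<close>.\<close>
    have "ix y x \<noteq> ix y x'" if x: "x \<in> W" "x' \<in> W" and e: "edge E1 x x'" for x x'
    proof
      assume eq: "ix y x = ix y x'"
      have x1: "x \<in> elts V1" "x' \<in> elts V1" using x W by blast+
      have "ix y x' = ix z x'" using fun_cong[OF hyz, of x'] x by (simp add: h_def)
      then have "app f (pr x y) = app f (pr x' z)"
        using ix(2) x1 yz eq by simp
      moreover have "edge E (pr x y) (pr x' z)"
        using product_graph_edge[OF prod] e yz(3) is_pair_pr x1 yz(1,2) elts_Univ by blast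
      ultimately show False using f(2) pV x1 yz by blast
    qed
    moreover have "ix y x \<in> {..<i}" if "x \<in> W" for x using ix(1) yz that W by auto
    ultimately show "\<exists>g. (\<forall>x\<in>W. g x \<in> {..<i}) \<and> (\<forall>x\<in>W. \<forall>y\<in>W. edge E1 x y \<longrightarrow> g x \<noteq> g y)"
      by blast
  qed simp
  then obtain g where g: "\<And>x. x \<in> elts V1 \<Longrightarrow> g x < i"
    "\<And>x y. x \<in> elts V1 \<Longrightarrow> y \<in> elts V1 \<Longrightarrow> edge E1 x y \<Longrightarrow> g x \<noteq> g y"
    by auto
  obtain c where "is_function c V1 (num i)" "\<And>x. x \<in> elts V1 \<Longrightarrow> app c x = num (g x)"
    by (rule encode_fun[OF V1U num_Univ, of "\<lambda>x. num (g x)" i m])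
      (use g m in \<open>auto simp: elts_num T_num\<close>)
  then show ?thesis
    unfolding colorable_def using g(2) by (auto simp: inj_eq[OF inj_num])
qed

text \<open>Projection gives the upper bound. For the lower bound, a coloring of the product with
  fewer than \<open>k\<close> colors would produce one of the first factor with as many.\<close>

lemma product_coloring: product_coloring_statement
  unfolding product_coloring_statement_def
proof (intro allI impI, elim conjE)
  fix k three V1 E1 V2 E2
  assume G: "graph V1 E1" "graph V2 E2" and lin: "linearly_orderable V1"
    and chi: "chromatic_number_is V1 E1 k" and inf: "chromatic_number_infinite V2 E2"
  obtain K where k: "k = num K"
    using chi unfolding chromatic_number_is_def natural_iff by blast
  obtain V E where prod: "product_graph V E V1 E1 V2 E2"
    by (rule product_graph_ex[OF G])
  have "colorable V E k"
    using colorable_product_of_factor[OF prod] G(1) chi num_Univ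
    by (simp add: graph_def chromatic_number_is_def k)
  moreover have "\<not> colorable V E j" if "j \<in> elts k" for j
    using colorable_factor_of_product[OF prod G lin inf] chi that
    unfolding chromatic_number_is_def k elts_num by blast
  ultimately have "chromatic_number_is V E k"
    using chi by (simp add: chromatic_number_is_def)
  with prod show "\<exists>V E. product_graph V E V1 E1 V2 E2 \<and> chromatic_number_is V E k" by blast
qed

end

section \<open>The hereditarily symmetric sets as an instance, and the final theorem\<close>

context klein_universe
begin

text \<open>\<open>HS\<close> is transitive, so its members have the same elements in the model as
  in the ground universe, and the closure properties of \<open>small\<close> restrict to it.\<close>

lemma klein_model_HS: "klein_model (S\<lparr>Univ := HS\<rparr>) small T at"
proof -
  interpret M: in_structure "S\<lparr>Univ := HS\<rparr>" .
  have elts_eq: "M.elts x = elts x" if "x \<in> HS" for x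
    using HS_elts[OF that] HS_subset_Univ by (auto simp: M.elts_def elts_def)
  have sets_eq: "M.sets = sets \<inter> HS"
    using HS_subset_Univ by (auto simp: M.sets_def sets_def)
  have elts_sub: "M.elts x \<subseteq> elts x" for x
    using HS_subset_Univ by (auto simp: M.elts_def elts_def)
  show ?thesis
  proof
    show "x = y" if "x \<in> M.sets" "y \<in> M.sets" "M.elts x = M.elts y" for x y
      using that extensionality by (simp add: sets_eq elts_eq)
    show "wf M.mem_rel"
      by (rule wf_subset[OF wf_mem_rel])
        (use HS_subset_Univ elts_sub in \<open>auto simp: M.mem_rel_def mem_rel_def\<close>)
    show "Atoms (S\<lparr>Univ := HS\<rparr>) \<subseteq> Univ (S\<lparr>Univ := HS\<rparr>)"
      using HS_Atoms by simp
    show "M.elts a = {}" if "a \<in> Atoms (S\<lparr>Univ := HS\<rparr>)" for a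
      using elts_atom[of a] elts_sub[of a] that by simp
    show "bij_betw at UNIV (Atoms (S\<lparr>Univ := HS\<rparr>))"
      using bij_at by simp
    show "T s (at i) = at (shift s i)" for s i by (rule T_at)
    show "T s x \<in> Univ (S\<lparr>Univ := HS\<rparr>)" if "x \<in> Univ (S\<lparr>Univ := HS\<rparr>)" for s x
      using that HS_T by simp
    show "T s x \<in> M.sets" if "x \<in> M.sets" for s x
      using that HS_T T_sets by (simp add: sets_eq)
    show "M.elts (T s x) = T s ` M.elts x" if "x \<in> Univ (S\<lparr>Univ := HS\<rparr>)" for s x
      using that HS_T elts_T HS_subset_Univ by (auto simp: elts_eq)
    show "T (add_shifts s t) x = T s (T t x)" if "x \<in> Univ (S\<lparr>Univ := HS\<rparr>)" for s t x
      using that T_add HS_subset_Univ by auto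
    show "T (\<lambda>_. (False, False)) x = x" if "x \<in> Univ (S\<lparr>Univ := HS\<rparr>)" for x
      using that T_zero HS_subset_Univ by auto
    show "\<exists>m. \<forall>s\<in>fix_blocks m. T s x = x" if "x \<in> Univ (S\<lparr>Univ := HS\<rparr>)" for x
      using that HS_support by simp
    show "\<exists>x\<in>M.sets. M.elts x = X" if "small X" "X \<subseteq> Univ (S\<lparr>Univ := HS\<rparr>)"
      "\<And>s x. s \<in> fix_blocks m \<Longrightarrow> x \<in> X \<Longrightarrow> T s x \<in> X" for X m
    proof -
      have "\<exists>x\<in>sets \<inter> HS. elts x = X"
        using that by (intro HS_sets_ex) simp_all
      then show ?thesis by (auto simp: sets_eq elts_eq)
    qed
    show "small (M.elts x)" if "x \<in> Univ (S\<lparr>Univ := HS\<rparr>)" for x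
      using that small_elts HS_subset_Univ by (auto simp: elts_eq)
    show "small (Atoms (S\<lparr>Univ := HS\<rparr>))" using small_Atoms by simp
    show "small Y" if "small X" "Y \<subseteq> X" for X Y using that by (rule small_subset)
    show "small (f ` X)" if "small X" "f ` X \<subseteq> Univ (S\<lparr>Univ := HS\<rparr>)" for f X
      using that HS_subset_Univ by (intro small_image) auto
    show "small (\<Union>i\<in>I. F i)" if "small I" "\<And>i. i \<in> I \<Longrightarrow> small (F i)" for I F
      using that by (rule small_UN)
    show "small {y \<in> M.sets. M.elts y \<subseteq> X}" if "small X" for X
      by (rule small_subset[OF small_Pow[OF that]]) (auto simp: sets_eq elts_eq)
    show "small (range g)" if "range g \<subseteq> Univ (S\<lparr>Univ := HS\<rparr>)" for g :: "nat \<Rightarrow> 'v"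
      using that HS_subset_Univ by (intro small_range) auto
  qed
qed

lemma permutation_model_HS: "permutation_model (S\<lparr>Univ := HS\<rparr>)"
  unfolding permutation_model_def HS_def using ground normal_filter_stabilizers by blast

end

theorem theorem4p10:
  fixes U :: "'v zfa_structure"
  assumes "in_structure.ground U" and "Atoms U = {}"
  shows "\<exists>N :: 'v zfa_structure.
    permutation_model N \<and>
    in_structure.ZFA N \<and>
    in_structure.CS N \<and>
    in_structure.CWF N \<and>
    \<not> in_structure.LOKW4_minus N \<and>
    in_structure.product_coloring_statement N \<and>
    in_structure.homomorphism_compactness_statement N \<and>
    in_structure.linear_functional_statement N"
proof -
  obtain S :: "'v zfa_structure" and a :: "nat \<Rightarrow> 'v"
    where S: "in_structure.ground S" and a: "bij_betw a UNIV (Atoms S)"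
    using ex_ground_with_atoms[OF assms] .
  have "infinite (UNIV :: (nat \<times> bool \<times> bool) set)"
    by (simp add: finite_prod)
  then obtain b :: "nat \<times> bool \<times> bool \<Rightarrow> nat" where "bij_betw b UNIV UNIV"
    using to_nat_on_infinite[of "UNIV :: (nat \<times> bool \<times> bool) set"] by auto
  then have "bij_betw (a \<circ> b) UNIV (Atoms S)"
    using a by (rule bij_betw_trans)
  with S interpret K: klein_universe S "a \<circ> b"
    by unfold_locales
  interpret M: klein_model "S\<lparr>Univ := K.HS\<rparr>" K.small K.T "a \<circ> b"
    by (rule K.klein_model_HS)
  show ?thesis
    using K.permutation_model_HS M.ZFA M.CS M.CWF M.not_LOKW4_minus M.product_coloring
      M.homomorphism_compactness M.linear_functional by blast
qed

end
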